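(* Let $\Bbbk$ be a field of characteristic zero with algebraic closure $\overline{\Bbbk}$. Let $K=K\{p(x)xy\}$ where $p\in\Bbbk[x]$ is a polynomial of degree $d\ge2$. Set $$E_p:=\{(a,b,e)\in\Bbbk^\times\times\Bbbk\times\{\pm1\}\mid a^{-1}(ax-b)\,p(ax-b)=e\,x\,p(x)\},$$ $$G_p:=\left\{\left(\begin{pmatrix} a & 0 \\ b & 1 \end{pmatrix},e\right)\;\middle|\;(a,b,e)\in E_p\right\}.$$ (1) $G_p$ is a subgroup of $GL_2(\Bbbk)\times\{\pm1\}$, and there is a short exact sequence of groups $$1\to\Bbbk(x)^\times\to\mathrm{Aut}_{Poi}(K)\to G_p\to1.$$ (2) $|G_p|\le d(d+1)$. (3) If $p$ has $\mathbb Z$-linearly independent roots $r_1,\dots,r_d$ in $\overline{\Bbbk}$ such that $r_i^{2d}\ne r_j^{2d}$ for all $i\ne j$, then $|G_p|=1$ and $\mathrm{Aut}_{Poi}(K)\cong\Bbbk(x)^\times$.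
   Context: For $\mathbf f\in\Bbbk(x,y)$, $K\{\mathbf f\}$ denotes the rational function field $\Bbbk(x,y)$ equipped with the unique ($\Bbbk$-bilinear) Poisson bracket such that $\{x,y\}=\mathbf f$; explicitly $\{g,h\}=\left(\frac{\partial g}{\partial x}\frac{\partial h}{\partial y}-\frac{\partial g}{\partial y}\frac{\partial h}{\partial x}\right)\mathbf f$. $\mathrm{Aut}_{Poi}(K)$ is the group of $\Bbbk$-algebra automorphisms of $K$ preserving the Poisson bracket. *)

theory Defs
  imports
    "HOL-Algebra.Algebraic_Closure_Type"
    "HOL-Algebra.Multiplicative_Group"
    "HOL-Analysis.Cartesian_Space"
begin

section \<open>The Poisson field on two generators\<close>

text \<open>
  The field \<open>k(x, y)\<close> is the fraction field of \<open>k[x][y]\<close>: the inner polynomial variable is \<open>x\<close>,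
  the outer one is \<open>y\<close>.
\<close>

type_synonym 'k ratfun2 = "'k poly poly fract"

definition rf_const :: "'k :: field \<Rightarrow> 'k ratfun2" where
  "rf_const c = to_fract [:[:c:]:]"

definition rf_X :: "'k :: field ratfun2" where
  "rf_X = to_fract [:[:0, 1:]:]"

definition rf_Y :: "'k :: field ratfun2" where
  "rf_Y = to_fract [:0, 1:]"

definition rf_of_poly_x :: "'k :: field poly \<Rightarrow> 'k ratfun2" where
  "rf_of_poly_x p = to_fract [:p:]"

lemma quotient_rule_well_defined:
  fixes D :: "'a :: idom \<Rightarrow> 'a"
  assumes D: "\<And>a b. D (a * b) = a * D b + D a * b"
    and b: "b \<noteq> 0" "d \<noteq> 0" and eq: "a * d = c * b"
  shows "(D a * b - a * D b) * (d * d) = (D c * d - c * D d) * (b * b)"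
proof -
  have "D (a * d) = D (c * b)" using eq by simp
  hence 1: "a * D d + D a * d = c * D b + D c * b" by (simp add: D)
  have "D a * b * (d * d) - a * D b * (d * d) =
      (a * D d + D a * d) * (b * d) - a * d * (b * D d) - a * d * (d * D b)"
    by (simp add: algebra_simps)
  also have "\<dots> = (c * D b + D c * b) * (b * d) - c * b * (b * D d) - c * b * (d * D b)"
    by (simp only: 1 eq)
  also have "\<dots> = D c * d * (b * b) - c * D d * (b * b)"
    by (simp add: algebra_simps)
  finally show ?thesis by (simp add: left_diff_distrib)
qed

text \<open>
  The extension of a derivation of an integral domain to its fraction field by the quotient rule.
\<close>

definition fract_deriv :: "('a :: idom \<Rightarrow> 'a) \<Rightarrow> 'a fract \<Rightarrow> 'a fract" where
  "fract_deriv D u =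
     (let (a, b) = (SOME (a, b). b \<noteq> 0 \<and> u = Fract a b)
      in Fract (D a * b - a * D b) (b * b))"

text \<open>By the product rule, the choice of the representing fraction does not matter.\<close>

lemma fract_deriv_Fract:
  fixes D :: "'a :: idom \<Rightarrow> 'a"
  assumes D: "\<And>a b. D (a * b) = a * D b + D a * b" and b: "b \<noteq> 0"
  shows "fract_deriv D (Fract a b) = Fract (D a * b - a * D b) (b * b)"
proof -
  define x where "x = (SOME (c, d). d \<noteq> 0 \<and> Fract a b = Fract c d)"
  obtain c d where x: "x = (c, d)" by (cases x)
  have "case x of (c, d) \<Rightarrow> d \<noteq> 0 \<and> Fract a b = Fract c d"
    unfolding x_def by (rule someI[of _ "(a, b)"]) (use b in simp)
  hence d: "d \<noteq> 0" and eq: "Fract a b = Fract c d" by (simp_all add: x)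
  have "a * d = c * b" using eq b d by (simp add: eq_fract)
  from quotient_rule_well_defined[OF D b d this]
  have "Fract (D a * b - a * D b) (b * b) = Fract (D c * d - c * D d) (d * d)"
    using b d by (simp add: eq_fract)
  thus ?thesis unfolding fract_deriv_def x_def[symmetric] x by simp
qed

text \<open>
  On \<open>k[x][y]\<close> the partial derivative with respect to \<open>y\<close> is \<^const>\<open>pderiv\<close>, the one with respect
  to \<open>x\<close> differentiates all coefficients. Both extend to \<open>k(x, y)\<close> by the quotient rule.
\<close>

lemma map_poly_pderiv_add:
  fixes a b :: "'k :: field poly poly"
  shows "map_poly pderiv (a + b) = map_poly pderiv a + map_poly pderiv b"
  by (rule poly_eqI) (simp add: coeff_map_poly pderiv_add)

lemma map_poly_pderiv_mult:
  fixes a b :: "'k :: field poly poly"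
  shows "map_poly pderiv (a * b) = a * map_poly pderiv b + map_poly pderiv a * b"
proof (induction a)
  case 0
  then show ?case by simp
next
  case (pCons c a)
  have smult: "map_poly pderiv (smult c b) = smult c (map_poly pderiv b) + smult (pderiv c) b"
    by (rule poly_eqI) (simp add: coeff_map_poly pderiv_mult)
  have pC: "map_poly pderiv (pCons u v) = pCons (pderiv u) (map_poly pderiv v)"
    for u :: "'k poly" and v
    by (rule poly_eqI) (simp add: coeff_map_poly coeff_pCons split: nat.splits)
  show ?case
    by (simp add: map_poly_pderiv_add smult pC pCons.IH algebra_simps smult_add_left)
qed

definition rf_dx :: "'k :: field ratfun2 \<Rightarrow> 'k ratfun2" where
  "rf_dx = fract_deriv (map_poly pderiv)"

definition rf_dy :: "'k :: field ratfun2 \<Rightarrow> 'k ratfun2" where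
  "rf_dy = fract_deriv pderiv"

lemma rf_dx_Fract:
  "b \<noteq> 0 \<Longrightarrow> rf_dx (Fract a b) = Fract (map_poly pderiv a * b - a * map_poly pderiv b) (b * b)"
  unfolding rf_dx_def by (rule fract_deriv_Fract[OF map_poly_pderiv_mult])

lemma rf_dy_Fract:
  "b \<noteq> 0 \<Longrightarrow> rf_dy (Fract a b) = Fract (pderiv a * b - a * pderiv b) (b * b)"
  unfolding rf_dy_def by (rule fract_deriv_Fract) (simp_all add: pderiv_mult mult.commute)

definition poisson_bracket ::
    "'k :: field ratfun2 \<Rightarrow> 'k ratfun2 \<Rightarrow> 'k ratfun2 \<Rightarrow> 'k ratfun2" where
  "poisson_bracket f g h = (rf_dx g * rf_dy h - rf_dy g * rf_dx h) * f"

lemma poisson_bracket_X_Y: "poisson_bracket f rf_X rf_Y = f"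
proof -
  have "rf_dx (rf_X :: 'a ratfun2) = 1" "rf_dy (rf_X :: 'a ratfun2) = 0"
       "rf_dx (rf_Y :: 'a ratfun2) = 0" "rf_dy (rf_Y :: 'a ratfun2) = 1"
    by (simp_all add: rf_X_def rf_Y_def to_fract_def rf_dx_Fract rf_dy_Fract map_poly_pCons
        pderiv_pCons One_fract_def Zero_fract_def eq_fract one_pCons)
  thus ?thesis by (simp add: poisson_bracket_def)
qed

definition poisson_auts :: "'k :: field ratfun2 \<Rightarrow> ('k ratfun2 \<Rightarrow> 'k ratfun2) set" where
  "poisson_auts f = {\<phi>. bij \<phi> \<and>
     (\<forall>u v. \<phi> (u + v) = \<phi> u + \<phi> v) \<and>
     (\<forall>u v. \<phi> (u * v) = \<phi> u * \<phi> v) \<and>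
     (\<forall>c. \<phi> (rf_const c) = rf_const c) \<and>
     (\<forall>u v. \<phi> (poisson_bracket f u v) = poisson_bracket f (\<phi> u) (\<phi> v))}"

definition Aut_Poi :: "'k :: field ratfun2 \<Rightarrow> ('k ratfun2 \<Rightarrow> 'k ratfun2) monoid" where
  "Aut_Poi f = \<lparr>carrier = poisson_auts f, monoid.mult = (\<circ>), one = id\<rparr>"


section \<open>Groups\<close>

definition ratfun_units :: "'k :: field poly fract monoid" where
  "ratfun_units = mult_of ring_of_type_algebra"

definition GL2 :: "('k :: field ^ 2 ^ 2) monoid" where
  "GL2 = \<lparr>carrier = {A. invertible A}, monoid.mult = (**), one = mat 1\<rparr>"

definition sign_group :: "int monoid" where
  "sign_group = \<lparr>carrier = {1, -1}, monoid.mult = (*), one = 1\<rparr>"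

text \<open>
  The library's \<open>exact_seq\<close> requires all groups to have the same element type; this is the
  heterogeneous version for short exact sequences \<open>1 \<rightarrow> A \<rightarrow> B \<rightarrow> C \<rightarrow> 1\<close>.
\<close>

definition short_exact ::
    "('a, 'm) monoid_scheme \<Rightarrow> ('b, 'n) monoid_scheme \<Rightarrow> ('c, 'l) monoid_scheme \<Rightarrow>
     ('a \<Rightarrow> 'b) \<Rightarrow> ('b \<Rightarrow> 'c) \<Rightarrow> bool" where
  "short_exact A B C \<iota> \<pi> \<longleftrightarrow> group A \<and> group B \<and> group C \<and>
     \<iota> \<in> mon A B \<and> \<pi> \<in> epi B C \<and> \<iota> ` carrier A = kernel B C \<pi>"

definition E_set :: "'k :: field poly \<Rightarrow> ('k \<times> 'k \<times> int) set" where
  "E_set p = {(a, b, e). a \<noteq> 0 \<and> e \<in> {1, -1} \<and>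
     smult (inverse a) ([:-b, a:] * pcompose p [:-b, a:]) = of_int e * [:0, 1:] * p}"

definition G_set :: "'k :: field poly \<Rightarrow> (('k ^ 2 ^ 2) \<times> int) set" where
  "G_set p = {(vector [vector [a, 0], vector [b, 1]], e) | a b e. (a, b, e) \<in> E_set p}"

abbreviation G_group :: "'k :: field poly \<Rightarrow> (('k ^ 2 ^ 2) \<times> int) monoid" where
  "G_group p \<equiv> (GL2 \<times>\<times> sign_group)\<lparr>carrier := G_set p\<rparr>"

lemma module_of_int: "Modules.module (\<lambda>n z. of_int n * z :: 'a :: comm_ring_1)"
  by unfold_locales (simp_all add: algebra_simps)

end

theory Submission
  imports Defs "Berlekamp_Zassenhaus.Unique_Factorization_Poly"
begin

text \<open>
  Write \<open>q = x p\<close>, so that \<open>{x, y} = q(x) y\<close>. The images \<open>u\<close>, \<open>v\<close> of \<open>x\<close>, \<open>y\<close> under a Poisson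
  automorphism satisfy \<open>{u, v} = q(u) v\<close>. If \<open>u\<close> had a pole of order \<open>m\<close> along a prime of \<open>k[x, y]\<close>,
  then \<open>q(u)\<close> would have a pole of order \<open>m (d + 1)\<close>, but \<open>{u, v} / v\<close> has one of order at most
  \<open>m + 1\<close>; since \<open>d \<ge> 2\<close>, \<open>u\<close> is a polynomial. The same comparison of degrees in \<open>y\<close> shows
  \<open>u \<in> k[x]\<close>, and leading coefficients in \<open>y\<close> give \<open>q(u) = n u' q\<close> with an integer \<open>n\<close>, which forces
  \<open>u = a x - b\<close>. Then \<open>y v\<^sub>y = n v\<close>, that is, \<open>v = h(x) y\<^sup>n\<close>, and invertibility gives \<open>n = 1\<close> or
  \<open>n = - 1\<close>.
\<close>

section \<open>Derivations of the fraction field\<close>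

text \<open>Nothing is known in advance about the zeros and poles of \<open>v\<close>. It therefore
  enters only through its logarithmic derivatives, whose poles along a prime are at most simple; the
  integer \<open>n\<close> is the y-degree of its numerator minus that of its denominator. Pairs (u,
  v) and automorphisms are linked by the chain rule: a homomorphism multiplies Jacobians by the
  Jacobian of the images of x and y, so preserving the bracket is one equation. Conversely, a pair
  with nonzero Jacobian may be substituted for (x, y), which is how automorphisms are built. The
  exponents of y for an automorphism and its inverse multiply to 1. For the size of the group, the
  condition on (a, b, e) says q(a x - b) = e a q(x). Leading coefficients give a^d = e, hence a^(2
  d) = 1, and \<open>a\<close> determines \<open>b\<close> because no nonzero translation preserves
  the finite root set of q. This yields at most 2 d elements, below the required d (d + 1), and
  reduces the third claim to a = 1.\<close>

lemma fract_deriv_add: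
  fixes D :: "'a :: idom \<Rightarrow> 'a"
  assumes D: "\<And>a b. D (a * b) = a * D b + D a * b" and A: "\<And>a b. D (a + b) = D a + D b"
  shows "fract_deriv D (u + v) = fract_deriv D u + fract_deriv D v"
proof -
  obtain a b where u: "u = Fract a b" "b \<noteq> 0" by (cases u) auto
  obtain c d where v: "v = Fract c d" "d \<noteq> 0" by (cases v) auto
  show ?thesis using u v
    by (simp add: fract_deriv_Fract[OF D] eq_fract D A) (simp add: algebra_simps)
qed

lemma fract_deriv_mult:
  fixes D :: "'a :: idom \<Rightarrow> 'a"
  assumes D: "\<And>a b. D (a * b) = a * D b + D a * b"
  shows "fract_deriv D (u * v) = fract_deriv D u * v + u * fract_deriv D v"
proof -
  obtain a b where u: "u = Fract a b" "b \<noteq> 0" by (cases u) auto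
  obtain c d where v: "v = Fract c d" "d \<noteq> 0" by (cases v) auto
  show ?thesis using u v
    by (simp add: fract_deriv_Fract[OF D] eq_fract D) (simp add: algebra_simps)
qed

lemma fract_deriv_to_fract:
  fixes D :: "'a :: idom \<Rightarrow> 'a"
  assumes D: "\<And>a b. D (a * b) = a * D b + D a * b"
  shows "fract_deriv D (to_fract a) = to_fract (D a)"
proof -
  have "D 1 = 0" using D[of 1 1] by (metis add_cancel_right_right mult_1 mult_1_right)
  thus ?thesis by (simp add: to_fract_def fract_deriv_Fract[OF D])
qed

locale field_derivation =
  fixes D :: "'a :: field \<Rightarrow> 'a"
  assumes add: "D (u + v) = D u + D v"
    and mult: "D (u * v) = D u * v + u * D v"
begin

lemma zero [simp]: "D 0 = 0"
  using add[of 0 0] by (metis add_cancel_right_right add_0)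

lemma one [simp]: "D 1 = 0"
  using mult[of 1 1] by (metis add_cancel_right_right mult_1 mult_1_right)

lemma minus: "D (- u) = - D u"
  using add[of u "- u"] by (simp add: eq_neg_iff_add_eq_0 add.commute)

lemma diff: "D (u - v) = D u - D v"
  using add[of u "- v"] by (simp add: minus)

lemma inverse: "u \<noteq> 0 \<Longrightarrow> D (inverse u) = - D u / u ^ 2"
  using mult[of u "inverse u"] by (simp add: field_simps power2_eq_square add_eq_0_iff2)

lemma divide: "v \<noteq> 0 \<Longrightarrow> D (u / v) = (D u * v - u * D v) / v ^ 2"
  by (simp add: divide_inverse mult inverse) (simp add: field_simps power2_eq_square)

lemma power: "D (u ^ n) = of_nat n * u ^ (n - 1) * D u"
proof (induction n)
  case (Suc n)
  have "of_nat n * (u * u ^ (n - Suc 0)) = of_nat n * u ^ n"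
    by (cases n) simp_all
  then show ?case
    by (simp add: mult Suc.IH algebra_simps)
qed simp

text \<open>The factor \<open>u\<close> keeps the exponent at \<open>n\<close> on both sides.
  Writing \<open>n\<close> as a difference of naturals reduces the claim to \<open>power\<close> and
  the quotient rule.\<close>

lemma power_int: "u \<noteq> 0 \<Longrightarrow> u * D (u powi n) = of_int n * u powi n * D u"
proof (cases n rule: int_diff_cases)
  case (diff i j)
  assume u: "u \<noteq> 0"
  have i: "u * D (u ^ i) = of_nat i * u ^ i * D u" for i
    unfolding power by (cases i) simp_all
  have "u * D (u ^ i / u ^ j) = (u * D (u ^ i) * u ^ j - u ^ i * (u * D (u ^ j))) / (u ^ j) ^ 2"
    using u by (simp add: divide algebra_simps)
  also have "\<dots> = (of_nat i - of_nat j) * (u ^ i / u ^ j) * D u"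
    using u unfolding i by (simp add: field_simps power2_eq_square)
  finally show ?thesis using u by (simp add: diff power_int_diff)
qed

end

section \<open>Generators of k[x][y] and k(x, y)\<close>

lemma poly_poly_induct [case_names const x y add mult]:
  fixes a :: "'k :: comm_semiring_1 poly poly"
  assumes const: "\<And>c. P [:[:c:]:]" and x: "P [:[:0, 1:]:]" and y: "P [:0, 1:]"
    and add: "\<And>a b. P a \<Longrightarrow> P b \<Longrightarrow> P (a + b)" and mult: "\<And>a b. P a \<Longrightarrow> P b \<Longrightarrow> P (a * b)"
  shows "P a"
proof -
  have x_poly: "P [:c:]" for c
  proof (induction c)
    case 0
    show ?case using const[of 0] by simp
  next
    case (pCons c q)
    have "[:pCons c q:] = [:[:c:]:] + [:[:0, 1:]:] * [:q:]" by simp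
    thus ?case using const x add mult pCons by metis
  qed
  show ?thesis
  proof (induction a)
    case 0
    show ?case using const[of 0] by simp
  next
    case (pCons c q)
    have "pCons c q = [:c:] + [:0, 1:] * q" by simp
    thus ?case using x_poly y add mult pCons by metis
  qed
qed

text \<open>The field k(x, y) is generated by k, x and y. Identities compatible with the field
  operations, and membership in a subfield, thus need checking on generators only.\<close>

lemma ratfun2_induct [case_names const X Y add mult inverse]:
  fixes w :: "'k :: field ratfun2"
  assumes const: "\<And>c. P (rf_const c)" and X: "P rf_X" and Y: "P rf_Y"
    and add: "\<And>u v. P u \<Longrightarrow> P v \<Longrightarrow> P (u + v)" and mult: "\<And>u v. P u \<Longrightarrow> P v \<Longrightarrow> P (u * v)"
    and inverse: "\<And>u. u \<noteq> 0 \<Longrightarrow> P u \<Longrightarrow> P (inverse u)"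
  shows "P w"
proof -
  have poly: "P (to_fract a)" for a
    by (induction a rule: poly_poly_induct)
      (use const X Y add mult in \<open>simp_all add: rf_const_def rf_X_def rf_Y_def\<close>)
  obtain a b where "w = Fract a b" "b \<noteq> 0" by (cases w) auto
  hence "w = to_fract a * inverse (to_fract b)" "to_fract b \<noteq> 0"
    by (simp_all add: Fract_conv_to_fract divide_inverse)
  thus ?thesis using poly mult inverse by metis
qed

lemma rf_dx_to_fract: "rf_dx (to_fract a) = to_fract (map_poly pderiv a)"
  unfolding rf_dx_def by (rule fract_deriv_to_fract[OF map_poly_pderiv_mult])

lemma rf_dy_to_fract: "rf_dy (to_fract a) = to_fract (pderiv a)"
  unfolding rf_dy_def by (rule fract_deriv_to_fract) (simp add: pderiv_mult mult.commute)

interpretation rf_dx: field_derivation rf_dx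
  unfolding rf_dx_def
  by unfold_locales (simp_all add: fract_deriv_add fract_deriv_mult map_poly_pderiv_mult map_poly_pderiv_add)

interpretation rf_dy: field_derivation rf_dy
  unfolding rf_dy_def
  by unfold_locales (simp_all add: fract_deriv_add fract_deriv_mult pderiv_mult pderiv_add mult.commute)

lemma map_poly_pderiv_pCons [simp]:
  "map_poly pderiv (pCons a q) = pCons (pderiv a) (map_poly pderiv q)"
  by (rule poly_eqI) (simp add: coeff_map_poly coeff_pCons split: nat.splits)

lemma map_poly_pderiv_1 [simp]: "map_poly pderiv 1 = 0"
  unfolding one_pCons map_poly_pderiv_pCons by simp

lemma rf_dx_simps [simp]: "rf_dx (rf_const c) = 0" "rf_dx rf_X = 1" "rf_dx rf_Y = 0"
  by (simp_all add: rf_const_def rf_X_def rf_Y_def rf_dx_to_fract pderiv_pCons flip: one_pCons)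

lemma rf_dy_simps [simp]: "rf_dy (rf_const c) = 0" "rf_dy rf_X = 0" "rf_dy rf_Y = 1"
  by (simp_all add: rf_const_def rf_X_def rf_Y_def rf_dy_to_fract pderiv_pCons flip: one_pCons)

lemma rf_const_simps [simp]:
  "rf_const 0 = 0" "rf_const 1 = 1" "rf_const (a + b) = rf_const a + rf_const b"
  "rf_const (a * b) = rf_const a * rf_const b" "rf_const (- a) = - rf_const a"
  "rf_const a = 0 \<longleftrightarrow> a = 0"
  by (simp_all add: rf_const_def flip: to_fract_add to_fract_mult to_fract_uminus one_pCons)

lemma rf_const_of_nat [simp]: "rf_const (of_nat n) = of_nat n"
  by (induction n) simp_all

lemma rf_const_of_int [simp]: "rf_const (of_int n) = of_int n"
  by (cases n) (simp_all del: of_nat_Suc)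

lemma rf_Y_nz [simp]: "rf_Y \<noteq> 0"
  by (simp add: rf_Y_def)

section \<open>Homomorphisms of k(x, y) over k and their Jacobians\<close>

abbreviation jacobian :: "'k :: field ratfun2 \<Rightarrow> 'k ratfun2 \<Rightarrow> 'k ratfun2" where
  "jacobian u v \<equiv> rf_dx u * rf_dy v - rf_dy u * rf_dx v"

text \<open>Bijectivity is kept out so that a substitution fits before its surjectivity is known;
  injectivity is automatic between fields.\<close>

locale ratfun2_hom =
  fixes \<phi> :: "'k :: field ratfun2 \<Rightarrow> 'k ratfun2"
  assumes add: "\<phi> (u + v) = \<phi> u + \<phi> v"
    and mult: "\<phi> (u * v) = \<phi> u * \<phi> v"
    and const [simp]: "\<phi> (rf_const c) = rf_const c"
begin

lemma zero [simp]: "\<phi> 0 = 0" using const[of 0] by simp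
lemma one [simp]: "\<phi> 1 = 1" using const[of 1] by simp

lemma minus: "\<phi> (- u) = - \<phi> u"
  using add[of u "- u"] by (simp add: eq_neg_iff_add_eq_0 add.commute)

lemma diff: "\<phi> (u - v) = \<phi> u - \<phi> v"
  using add[of u "- v"] by (simp add: minus)

lemma nonzero [simp]: "\<phi> u = 0 \<longleftrightarrow> u = 0"
  using mult[of u "inverse u"] by (cases "u = 0") auto

lemma inj: "inj \<phi>"
  by (rule injI) (metis diff nonzero eq_iff_diff_eq_0)

lemma hom_inverse: "\<phi> (inverse u) = inverse (\<phi> u)"
  using mult[of u "inverse u"] by (cases "u = 0") (simp_all add: inverse_unique)

lemma power: "\<phi> (u ^ n) = \<phi> u ^ n"
  by (induction n) (simp_all add: mult)

lemma power_int: "\<phi> (u powi n) = \<phi> u powi n"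
  by (simp add: power_int_def power hom_inverse)

text \<open>As functions of \<open>w\<close>, both sides are additive, satisfy the Leibniz rule
  along \<phi> and agree on constants, x and y. A general \<open>D\<close> serves both partial
  derivatives at once.\<close>

lemma chain_rule:
  assumes "field_derivation D" and "\<And>c. D (rf_const c) = 0"
  shows "D (\<phi> w) = \<phi> (rf_dx w) * D (\<phi> rf_X) + \<phi> (rf_dy w) * D (\<phi> rf_Y)"
proof -
  interpret D: field_derivation D by fact
  show ?thesis
  proof (induction w rule: ratfun2_induct)
    case (inverse u)
    then show ?case
      by (simp add: hom_inverse D.inverse rf_dx.inverse rf_dy.inverse divide_inverse minus mult power)
        (simp add: algebra_simps)
  qed (simp_all add: assms(2) local.add local.mult D.add D.mult rf_dx.add rf_dx.mult rf_dy.add rf_dy.mult algebra_simps)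
qed

text \<open>By the chain rule the Jacobian matrix of the images is a product of two matrices; this
  is the product rule for their determinants.\<close>

lemma jacobian_hom:
  "jacobian (\<phi> u) (\<phi> v) = \<phi> (jacobian u v) * jacobian (\<phi> rf_X) (\<phi> rf_Y)"
proof -
  note dx = chain_rule[OF rf_dx.field_derivation_axioms rf_dx_simps(1)]
  note dy = chain_rule[OF rf_dy.field_derivation_axioms rf_dy_simps(1)]
  show ?thesis
    unfolding dx[of u] dx[of v] dy[of u] dy[of v] by (simp add: diff mult algebra_simps)
qed

text \<open>\<open>jacobian_hom\<close> splits the same factor \<open>\<phi> (jacobian u v)\<close>
  off both sides, which leaves a single equation on the images of x and y.\<close>

lemma preserves_bracket_iff:
  "(\<forall>u v. \<phi> (poisson_bracket f u v) = poisson_bracket f (\<phi> u) (\<phi> v)) \<longleftrightarrow>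
     poisson_bracket f (\<phi> rf_X) (\<phi> rf_Y) = \<phi> f"
proof
  assume "\<forall>u v. \<phi> (poisson_bracket f u v) = poisson_bracket f (\<phi> u) (\<phi> v)"
  thus "poisson_bracket f (\<phi> rf_X) (\<phi> rf_Y) = \<phi> f"
    by (metis poisson_bracket_X_Y)
next
  assume *: "poisson_bracket f (\<phi> rf_X) (\<phi> rf_Y) = \<phi> f"
  show "\<forall>u v. \<phi> (poisson_bracket f u v) = poisson_bracket f (\<phi> u) (\<phi> v)"
  proof (intro allI)
    fix u v
    have "\<phi> (poisson_bracket f u v) = \<phi> (jacobian u v) * \<phi> f"
      unfolding poisson_bracket_def by (rule mult)
    also have "\<dots> = poisson_bracket f (\<phi> u) (\<phi> v)"
      unfolding *[symmetric] poisson_bracket_def jacobian_hom[of u v] by (rule mult.assoc[symmetric])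
    finally show "\<phi> (poisson_bracket f u v) = poisson_bracket f (\<phi> u) (\<phi> v)" .
  qed
qed

end

lemma ratfun2_hom_eqI:
  assumes "ratfun2_hom \<phi>" "ratfun2_hom \<psi>" "\<phi> rf_X = \<psi> rf_X" "\<phi> rf_Y = \<psi> rf_Y"
  shows "\<phi> = \<psi>"
proof
  interpret \<phi>: ratfun2_hom \<phi> by fact
  interpret \<psi>: ratfun2_hom \<psi> by fact
  show "\<phi> w = \<psi> w" for w
    by (induction w rule: ratfun2_induct)
      (simp_all add: assms \<phi>.add \<psi>.add \<phi>.mult \<psi>.mult \<phi>.hom_inverse \<psi>.hom_inverse)
qed

lemma ratfun2_hom_comp: "ratfun2_hom \<phi> \<Longrightarrow> ratfun2_hom \<psi> \<Longrightarrow> ratfun2_hom (\<phi> \<circ> \<psi>)"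
  by (simp add: ratfun2_hom_def)

lemma poisson_auts_iff:
  "\<phi> \<in> poisson_auts f \<longleftrightarrow> bij \<phi> \<and> ratfun2_hom \<phi> \<and> poisson_bracket f (\<phi> rf_X) (\<phi> rf_Y) = \<phi> f"
  using ratfun2_hom.preserves_bracket_iff[of \<phi> f]
  by (auto simp: poisson_auts_def ratfun2_hom_def)

section \<open>Substitution homomorphisms\<close>

text \<open>Universal property of the fraction field. A fraction has many representations;
  injectivity of \<open>h\<close> keeps denominators nonzero and makes the chosen value
  unique.\<close>

definition fract_lift :: "('a :: idom \<Rightarrow> 'b :: field) \<Rightarrow> 'a fract \<Rightarrow> 'b" where
  "fract_lift h w = (SOME z. \<exists>a b. b \<noteq> 0 \<and> w = Fract a b \<and> z = h a / h b)"

lemma fract_lift_Fract: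
  assumes "inj_idom_hom h" and b: "b \<noteq> 0"
  shows "fract_lift h (Fract a b) = h a / h b"
proof -
  interpret inj_idom_hom h by fact
  have "\<exists>c d. d \<noteq> 0 \<and> Fract a b = Fract c d \<and> fract_lift h (Fract a b) = h c / h d"
    unfolding fract_lift_def by (rule someI[of _ "h a / h b"]) (use b in blast)
  then obtain c d where d: "d \<noteq> 0" and eq: "Fract a b = Fract c d"
    and lift: "fract_lift h (Fract a b) = h c / h d"
    by blast
  have "a * d = c * b" using eq b d by (simp add: eq_fract)
  hence "h a * h d = h c * h b" by (metis hom_mult)
  thus ?thesis using b d lift by (simp add: frac_eq_eq)
qed

lemma fract_lift_to_fract: "inj_idom_hom h \<Longrightarrow> fract_lift h (to_fract a) = h a"
proof -
  assume h: "inj_idom_hom h"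
  interpret inj_idom_hom h by fact
  show ?thesis unfolding to_fract_def by (simp add: fract_lift_Fract[OF h])
qed

lemma fract_lift_hom:
  assumes h: "inj_idom_hom h"
  shows "inj_idom_hom (fract_lift h)"
proof -
  interpret inj_idom_hom h by fact
  note lift = fract_lift_Fract[OF h]
  show ?thesis
  proof unfold_locales
    fix u v :: "'a fract"
    obtain a b where u: "u = Fract a b" "b \<noteq> 0" by (cases u) auto
    obtain c d where v: "v = Fract c d" "d \<noteq> 0" by (cases v) auto
    show "fract_lift h (u + v) = fract_lift h u + fract_lift h v"
      using u v by (simp add: lift hom_add hom_mult field_simps)
    show "fract_lift h (u * v) = fract_lift h u * fract_lift h v"
      using u v by (simp add: lift hom_mult)
    show "fract_lift h u = 0 \<Longrightarrow> u = 0"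
      using u by (auto simp: lift Zero_fract_def eq_fract)
  qed (use lift[of 1 0] lift[of 1 1] in \<open>simp_all add: Zero_fract_def One_fract_def\<close>)
qed

interpretation rf_const: inj_idom_hom rf_const
  by unfold_locales simp_all

definition rf_eval_x :: "'k :: field ratfun2 \<Rightarrow> 'k poly \<Rightarrow> 'k ratfun2" where
  "rf_eval_x u c = poly (map_poly rf_const c) u"

definition rf_eval :: "'k :: field ratfun2 \<Rightarrow> 'k ratfun2 \<Rightarrow> 'k poly poly \<Rightarrow> 'k ratfun2" where
  "rf_eval u v a = poly (map_poly (rf_eval_x u) a) v"

interpretation rf_eval_x: idom_hom "rf_eval_x u"
proof -
  interpret m: map_poly_idom_hom rf_const ..
  show "idom_hom (rf_eval_x u)"
    by unfold_locales (simp_all add: rf_eval_x_def m.hom_add m.hom_mult)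
qed

interpretation rf_eval: idom_hom "rf_eval u v"
proof -
  interpret m: map_poly_idom_hom "rf_eval_x u" ..
  show "idom_hom (rf_eval u v)"
    by unfold_locales (simp_all add: rf_eval_def m.hom_add m.hom_mult)
qed

lemma rf_eval_x_pCons: "rf_eval_x u (pCons c q) = rf_const c + u * rf_eval_x u q"
  by (simp add: rf_eval_x_def rf_const.map_poly_pCons_hom)

lemma rf_eval_pCons: "rf_eval u v (pCons c a) = rf_eval_x u c + v * rf_eval u v a"
  by (simp add: rf_eval_def rf_eval_x.map_poly_pCons_hom)

lemma rf_eval_x_simps [simp]: "rf_eval_x u [:c:] = rf_const c" "rf_eval_x u [:c, d:] = rf_const c + rf_const d * u"
  "rf_eval_x u (pCons 0 1) = u"
  by (simp_all add: rf_eval_x_pCons)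

lemma rf_eval_simps [simp]: "rf_eval u v [:c:] = rf_eval_x u c" "rf_eval u v (pCons 0 1) = v"
  by (simp_all add: rf_eval_pCons)

lemma rf_eval_x_X: "rf_eval_x rf_X c = rf_of_poly_x c"
proof (induction c)
  case (pCons c q)
  have "rf_of_poly_x (pCons c q) = rf_const c + rf_X * rf_of_poly_x q"
    by (simp add: rf_of_poly_x_def rf_const_def rf_X_def flip: to_fract_add to_fract_mult)
  with pCons show ?case by (simp add: rf_eval_x_pCons)
qed (simp add: rf_of_poly_x_def)

lemma rf_eval_chain_rule:
  assumes "field_derivation D" and "\<And>c. D (rf_const c) = 0"
  shows "D (rf_eval u v a) = rf_eval u v (map_poly pderiv a) * D u + rf_eval u v (pderiv a) * D v"
proof -
  interpret D: field_derivation D by fact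
  show ?thesis
  proof (induction a rule: poly_poly_induct)
    case (mult a b)
    then show ?case
      by (simp add: rf_eval.hom_mult rf_eval.hom_add D.mult map_poly_pderiv_mult pderiv_mult algebra_simps)
  qed (simp_all add: assms(2) rf_eval.hom_add D.add map_poly_pderiv_add pderiv_add pderiv_pCons
        algebra_simps)
qed

text \<open>The row (s, t) is annihilated by a matrix of nonzero determinant; multiplying by the
  adjugate avoids division.\<close>

lemma cramer_zero:
  fixes a b c d s t :: "'a :: idom"
  assumes "a * d - b * c \<noteq> 0" and "s * a + t * c = 0" and "s * b + t * d = 0"
  shows "s = 0" "t = 0"
proof -
  have "s * (a * d - b * c) = (s * a + t * c) * d - (s * b + t * d) * c"
       "t * (a * d - b * c) = (s * b + t * d) * a - (s * a + t * c) * b"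
    by (simp_all add: algebra_simps)
  thus "s = 0" "t = 0" using assms by simp_all
qed

text \<open>
  The Jacobian criterion: if \<open>a(u, v) = 0\<close>, then the chain rule makes both partial derivatives of \<open>a\<close>
  vanish at \<open>(u, v)\<close>, so that a nonzero \<open>a\<close> of minimal degree has to be constant.
\<close>

lemma rf_eval_inj:
  fixes u v :: "'k :: field_char_0 ratfun2"
  assumes J: "jacobian u v \<noteq> 0"
  shows "inj_idom_hom (rf_eval u v)"
proof unfold_locales
  note chain = rf_eval_chain_rule[OF rf_dx.field_derivation_axioms rf_dx_simps(1), of u v]
    rf_eval_chain_rule[OF rf_dy.field_derivation_axioms rf_dy_simps(1), of u v]
  have d0: "rf_eval u v (map_poly pderiv a) = 0 \<and> rf_eval u v (pderiv a) = 0"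
    if "rf_eval u v a = 0" for a
  proof -
    have "rf_eval u v (map_poly pderiv a) * rf_dx u + rf_eval u v (pderiv a) * rf_dx v = 0"
      by (metis chain(1) that rf_dx.zero)
    moreover have "rf_eval u v (map_poly pderiv a) * rf_dy u + rf_eval u v (pderiv a) * rf_dy v = 0"
      by (metis chain(2) that rf_dy.zero)
    ultimately show ?thesis by (metis cramer_zero[OF J])
  qed
  \<comment> \<open>Polynomials in x alone come first, because the descent in the y-degree below
    ends with one of them.\<close>
  have const: "c = 0" if "rf_eval u v [:c:] = 0" for c
    using that
  proof (induction "Polynomial.degree c" arbitrary: c rule: less_induct)
    case less
    have "rf_eval u v [:pderiv c:] = 0"
      using d0[OF less.prems] by simp
    hence "Polynomial.degree c \<noteq> 0 \<Longrightarrow> pderiv c = 0"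
      using less.hyps[of "pderiv c"] by (simp add: degree_pderiv)
    hence "Polynomial.degree c = 0" by (auto simp: pderiv_eq_0_iff)
    then obtain e where "c = [:e:]" by (auto elim: degree_eq_zeroE)
    with less.prems show ?case by simp
  qed
  show "a = 0" if "rf_eval u v a = 0" for a
    using that
  proof (induction "Polynomial.degree a" arbitrary: a rule: less_induct)
    case less
    have "rf_eval u v (pderiv a) = 0"
      using d0[OF less.prems] by simp
    hence "Polynomial.degree a \<noteq> 0 \<Longrightarrow> pderiv a = 0"
      using less.hyps[of "pderiv a"] by (simp add: degree_pderiv)
    hence "Polynomial.degree a = 0" by (auto simp: pderiv_eq_0_iff)
    then obtain e where "a = [:e:]" by (auto elim: degree_eq_zeroE)
    with less.prems const show ?case by simp
  qed
qed

definition rf_subst :: "'k :: field ratfun2 \<Rightarrow> 'k ratfun2 \<Rightarrow> 'k ratfun2 \<Rightarrow> 'k ratfun2" where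
  "rf_subst u v = fract_lift (rf_eval u v)"

lemma rf_subst:
  fixes u v :: "'k :: field_char_0 ratfun2"
  assumes J: "jacobian u v \<noteq> 0"
  shows "ratfun2_hom (rf_subst u v)" "rf_subst u v rf_X = u" "rf_subst u v rf_Y = v"
proof -
  note inj = rf_eval_inj[OF J]
  interpret inj_idom_hom "rf_subst u v"
    unfolding rf_subst_def by (rule fract_lift_hom[OF inj])
  note lift = fract_lift_to_fract[OF inj, folded rf_subst_def]
  show "ratfun2_hom (rf_subst u v)"
  proof
    show "rf_subst u v (rf_const c) = rf_const c" for c
      unfolding rf_const_def lift by (simp add: rf_const_def)
  qed (rule hom_add hom_mult)+
  show "rf_subst u v rf_X = u" "rf_subst u v rf_Y = v"
    by (simp_all add: rf_X_def rf_Y_def lift)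
qed

lemma (in ratfun2_hom) hom_rf_eval_x: "\<phi> (rf_eval_x u c) = rf_eval_x (\<phi> u) c"
  by (induction c) (simp_all add: rf_eval_x_pCons add mult)

definition rf_of_x :: "'k :: field poly fract \<Rightarrow> 'k ratfun2" where
  "rf_of_x = fract_lift rf_of_poly_x"

lemma rf_of_poly_x_hom: "inj_idom_hom (rf_of_poly_x :: 'k :: field poly \<Rightarrow> 'k ratfun2)"
proof unfold_locales
  show "rf_of_poly_x (a + b) = rf_of_poly_x a + rf_of_poly_x b"
    and "rf_of_poly_x (a * b) = rf_of_poly_x a * rf_of_poly_x b" for a b :: "'k poly"
    using to_fract_add[of "[:a:]" "[:b:]"] to_fract_mult[of "[:a:]" "[:b:]"]
    by (simp_all add: rf_of_poly_x_def mult.commute)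
qed (simp_all add: rf_of_poly_x_def flip: one_pCons)

interpretation rf_of_x: inj_idom_hom rf_of_x
  unfolding rf_of_x_def by (rule fract_lift_hom[OF rf_of_poly_x_hom])

interpretation rf_of_x: field_hom rf_of_x ..

lemma rf_of_x_to_fract [simp]: "rf_of_x (to_fract c) = rf_of_poly_x c"
  unfolding rf_of_x_def by (rule fract_lift_to_fract[OF rf_of_poly_x_hom])

section \<open>Poles along a prime\<close>

text \<open>The localization at the prime \<pi>. No valuation is introduced: a pole of order at most
  m means that multiplication by the m-th power of \<pi> leads into this ring.\<close>

definition regular_at :: "'a :: idom \<Rightarrow> 'a fract set" where
  "regular_at \<pi> = {Fract a s | a s. \<not> \<pi> dvd s}"

lemma regular_atI: "\<not> \<pi> dvd s \<Longrightarrow> Fract a s \<in> regular_at \<pi>"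
  by (auto simp: regular_at_def)

lemma regular_atE:
  assumes "w \<in> regular_at \<pi>"
  obtains a s where "w = Fract a s" "\<not> \<pi> dvd s" "s \<noteq> 0"
  using assms by (auto simp: regular_at_def)

lemma to_fract_regular: "prime_elem \<pi> \<Longrightarrow> to_fract a \<in> regular_at \<pi>"
  unfolding to_fract_def by (rule regular_atI) (auto simp: prime_elem_def)

context
  fixes \<pi> :: "'a :: idom"
  assumes \<pi>: "prime_elem \<pi>"
begin

lemma regular_at_add: "u \<in> regular_at \<pi> \<Longrightarrow> v \<in> regular_at \<pi> \<Longrightarrow> u + v \<in> regular_at \<pi>"
proof -
  assume "u \<in> regular_at \<pi>" "v \<in> regular_at \<pi>"
  then obtain a b c d where "u = Fract a b" "\<not> \<pi> dvd b" "b \<noteq> 0" "v = Fract c d" "\<not> \<pi> dvd d" "d \<noteq> 0"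
    by (auto elim!: regular_atE)
  thus ?thesis using \<pi> by (auto simp: prime_elem_dvd_mult_iff intro!: regular_atI)
qed

lemma regular_at_mult: "u \<in> regular_at \<pi> \<Longrightarrow> v \<in> regular_at \<pi> \<Longrightarrow> u * v \<in> regular_at \<pi>"
proof -
  assume "u \<in> regular_at \<pi>" "v \<in> regular_at \<pi>"
  then obtain a b c d where "u = Fract a b" "\<not> \<pi> dvd b" "b \<noteq> 0" "v = Fract c d" "\<not> \<pi> dvd d" "d \<noteq> 0"
    by (auto elim!: regular_atE)
  thus ?thesis using \<pi> by (auto simp: prime_elem_dvd_mult_iff intro!: regular_atI)
qed

lemma regular_at_minus: "u \<in> regular_at \<pi> \<Longrightarrow> - u \<in> regular_at \<pi>"
  by (auto elim!: regular_atE intro!: regular_atI)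

lemma regular_at_diff: "u \<in> regular_at \<pi> \<Longrightarrow> v \<in> regular_at \<pi> \<Longrightarrow> u - v \<in> regular_at \<pi>"
  using regular_at_add[OF _ regular_at_minus] by simp

lemma regular_at_0: "0 \<in> regular_at \<pi>"
  using to_fract_regular[OF \<pi>, of 0] by simp

lemma regular_at_1: "1 \<in> regular_at \<pi>"
  using to_fract_regular[OF \<pi>, of 1] by simp

lemma regular_at_power: "u \<in> regular_at \<pi> \<Longrightarrow> u ^ n \<in> regular_at \<pi>"
  by (induction n) (auto intro: regular_at_mult regular_at_1)

lemma regular_at_of_int: "of_int n \<in> regular_at \<pi>"
proof -
  have "of_int n = to_fract (of_int n :: 'a)"
    by (simp add: to_fract_hom.hom_of_int)
  thus ?thesis using to_fract_regular[OF \<pi>] by metis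
qed

lemma regular_at_sum: "(\<And>i. i \<in> A \<Longrightarrow> g i \<in> regular_at \<pi>) \<Longrightarrow> sum g A \<in> regular_at \<pi>"
  by (induction A rule: infinite_finite_induct) (auto intro: regular_at_add regular_at_0)

text \<open>\<pi> is not invertible in its localization; the contradiction in
  \<open>rf_eval_x_pole\<close> comes from here.\<close>

lemma prime_times_regular_not_unit:
  assumes "w \<in> regular_at \<pi>"
  shows "to_fract \<pi> * w \<noteq> 1"
  using assms by (auto elim!: regular_atE simp: to_fract_def One_fract_def eq_fract)

lemma fract_deriv_regular:
  assumes D: "\<And>a b. D (a * b) = a * D b + D a * b" and w: "w \<in> regular_at \<pi>"
  shows "fract_deriv D w \<in> regular_at \<pi>"
proof -
  obtain a s where "w = Fract a s" "\<not> \<pi> dvd s" "s \<noteq> 0" using w by (rule regular_atE)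
  thus ?thesis using \<pi>
    by (auto simp: fract_deriv_Fract[OF D] prime_elem_dvd_mult_iff intro!: regular_atI)
qed

text \<open>
  With \<open>u = t\<^sup>-\<^sup>m u\<^sub>0\<close> and \<open>D v / v = n D t / t + w\<close>, the terms of order \<open>- m - 2\<close> in
  \<open>(D\<^sub>1 u D\<^sub>2 v - D\<^sub>2 u D\<^sub>1 v) / v\<close> cancel.
\<close>

lemma jacobian_pole_bound:
  fixes D1 D2 :: "'a fract \<Rightarrow> 'a fract"
  defines "t \<equiv> to_fract \<pi>"
  assumes D: "field_derivation D1" "field_derivation D2"
    and reg: "\<And>w. w \<in> regular_at \<pi> \<Longrightarrow> D1 w \<in> regular_at \<pi>" "\<And>w. w \<in> regular_at \<pi> \<Longrightarrow> D2 w \<in> regular_at \<pi>"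
    and u: "t ^ m * u \<in> regular_at \<pi>"
    and w: "w1 \<in> regular_at \<pi>" "w2 \<in> regular_at \<pi>"
    and v: "D1 v / v = of_int n * D1 t / t + w1" "D2 v / v = of_int n * D2 t / t + w2"
  shows "t ^ (m + 1) * ((D1 u * D2 v - D2 u * D1 v) / v) \<in> regular_at \<pi>"
proof -
  interpret D1: field_derivation D1 by fact
  interpret D2: field_derivation D2 by fact
  have t: "t \<in> regular_at \<pi>" unfolding t_def by (rule to_fract_regular[OF \<pi>])
  have t0: "t \<noteq> 0" using \<pi> by (auto simp: t_def)
  define u0 where "u0 = t ^ m * u"
  have Du: "t ^ (m + 1) * D u = t * D u0 - of_int (int m) * u0 * D t" if "field_derivation D" for D
  proof -
    interpret D: field_derivation D by fact
    show ?thesis unfolding u0_def D.mult D.power by (cases m) (simp_all add: algebra_simps)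
  qed
  \<comment> \<open>Writing the derivatives of \<open>t\<close> as multiples of \<open>t\<close>
    turns the divisions by \<open>t\<close> into cancellations.\<close>
  obtain e1 e2 where e: "D1 t = t * e1" "D2 t = t * e2"
    using t0 by (metis nonzero_mult_div_cancel_left times_divide_eq_right)
  have "t ^ (m + 1) * ((D1 u * D2 v - D2 u * D1 v) / v) =
      (t ^ (m + 1) * D1 u) * (D2 v / v) - (t ^ (m + 1) * D2 u) * (D1 v / v)"
    by (simp add: algebra_simps diff_divide_distrib)
  also have "\<dots> = of_int n * (D1 u0 * D2 t - D2 u0 * D1 t)
      + (t * D1 u0 - of_int (int m) * u0 * D1 t) * w2 - (t * D2 u0 - of_int (int m) * u0 * D2 t) * w1"
    unfolding Du[OF D(1)] Du[OF D(2)] v e using t0 by (simp add: algebra_simps)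
  finally have eq: "t ^ (m + 1) * ((D1 u * D2 v - D2 u * D1 v) / v) = \<dots>" .
  have "u0 \<in> regular_at \<pi>" unfolding u0_def by (rule u)
  thus ?thesis
    unfolding eq using t w by (intro regular_at_add regular_at_diff regular_at_mult regular_at_of_int reg)
qed

end

text \<open>Multiplicities of a prime exist in a UFD because they add up over the factors of a product.\<close>

lemma ufd_prime_decompose:
  fixes a \<pi> :: "'a :: ufd"
  assumes \<pi>: "prime_elem \<pi>" and a: "a \<noteq> 0"
  shows "\<exists>m b. a = \<pi> ^ m * b \<and> \<not> \<pi> dvd b"
proof -
  let ?P = "\<lambda>a. \<exists>m b. a = \<pi> ^ m * b \<and> \<not> \<pi> dvd b"
  have unit: "?P a" if "a dvd 1" for a
    using that \<pi> by (intro exI[of _ 0] exI[of _ a]) (auto simp: prime_elem_def intro: dvd_trans)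
  have mult: "?P (a * b)" if "?P a" "?P b" for a b
  proof -
    from that obtain m c n d where "a = \<pi> ^ m * c" "\<not> \<pi> dvd c" "b = \<pi> ^ n * d" "\<not> \<pi> dvd d"
      by blast
    hence "a * b = \<pi> ^ (m + n) * (c * d)" "\<not> \<pi> dvd c * d"
      using \<pi> by (simp_all add: prime_elem_dvd_mult_iff power_add mult_ac)
    thus ?thesis by blast
  qed
  have irred: "?P f" if "irreducible f" for f
  proof (cases "\<pi> dvd f")
    case True
    then obtain b where f: "f = \<pi> * b" by (elim dvdE)
    have "b dvd 1" using that f \<pi> by (auto simp: irreducible_def prime_elem_def)
    hence "\<not> \<pi> dvd b" using \<pi> by (meson dvd_trans prime_elem_def)
    thus ?thesis using f by (intro exI[of _ 1] exI[of _ b]) simp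
  next
    case False
    thus ?thesis by (intro exI[of _ 0] exI[of _ f]) simp
  qed
  show ?thesis
  proof (cases "a dvd 1")
    case False
    then obtain F where F: "mset_factors F a" using mset_factors_exist a by blast
    have *: "?P (prod_mset F)" if "\<And>f. f \<in># F \<Longrightarrow> irreducible f" for F
      using that
    proof (induction F)
      case empty
      show ?case using unit[of 1] by simp
    next
      case (add f F)
      have "?P (f * prod_mset F)"
        by (rule mult[OF irred add.IH]) (use add.prems in simp_all)
      thus ?case by simp
    qed
    have "prod_mset F = a" "\<And>f. f \<in># F \<Longrightarrow> irreducible f"
      using F by (simp_all add: mset_factors_def)
    with *[of F] show ?thesis by metis
  qed (rule unit)
qed

text \<open>The exponent is an integer since \<open>v\<close> may have a zero or a pole along \<pi>;
  \<open>v0\<close> is a unit of the local ring, so its logarithmic derivatives are regular.\<close>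

lemma prime_power_decompose:
  fixes v :: "'a :: ufd fract"
  assumes \<pi>: "prime_elem \<pi>" and v: "v \<noteq> 0"
  obtains n v0 where "v = to_fract \<pi> powi n * v0" "v0 \<in> regular_at \<pi>" "inverse v0 \<in> regular_at \<pi>" "v0 \<noteq> 0"
proof -
  obtain a b where ab: "v = Fract a b" "b \<noteq> 0" by (cases v) auto
  with v have a: "a \<noteq> 0" by (auto simp: Zero_fract_def eq_fract)
  obtain i c where c: "a = \<pi> ^ i * c" "\<not> \<pi> dvd c" using ufd_prime_decompose[OF \<pi> a] by blast
  obtain j d where d: "b = \<pi> ^ j * d" "\<not> \<pi> dvd d" using ufd_prime_decompose[OF \<pi> ab(2)] by blast
  have cd: "c \<noteq> 0" "d \<noteq> 0" using c d by auto
  have \<pi>0: "\<pi> \<noteq> 0" using \<pi> by auto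
  have "v = to_fract \<pi> powi (int i - int j) * Fract c d"
    using \<pi>0 cd unfolding ab c d
    by (simp add: Fract_conv_to_fract power_int_diff to_fract_hom.hom_power)
  moreover have "Fract c d \<in> regular_at \<pi>" "inverse (Fract c d) \<in> regular_at \<pi>"
    using c d by (simp_all add: regular_atI)
  moreover have "Fract c d \<noteq> 0" using cd by (simp add: Zero_fract_def eq_fract)
  ultimately show thesis by (rule that)
qed

lemma rf_eval_x_sum: "rf_eval_x u q = (\<Sum>i\<le>Polynomial.degree q. rf_const (coeff q i) * u ^ i)"
  unfolding rf_eval_x_def poly_altdef by simp

lemma rf_dx_regular: "prime_elem \<pi> \<Longrightarrow> w \<in> regular_at \<pi> \<Longrightarrow> rf_dx w \<in> regular_at \<pi>"
  unfolding rf_dx_def by (rule fract_deriv_regular[OF _ map_poly_pderiv_mult])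

lemma rf_dy_regular: "prime_elem \<pi> \<Longrightarrow> w \<in> regular_at \<pi> \<Longrightarrow> rf_dy w \<in> regular_at \<pi>"
  unfolding rf_dy_def by (rule fract_deriv_regular) (simp_all add: pderiv_mult mult.commute)

text \<open>After multiplication by \<open>t ^ (m * N)\<close> the leading term of q(u) becomes a
  unit and all lower terms are divisible by \<open>t\<close>. Were the claim false, the whole sum
  would be divisible by \<open>t\<close> as well, and so would the unit.\<close>

lemma rf_eval_x_pole:
  fixes \<pi> :: "'k :: field poly poly"
  defines "t \<equiv> to_fract \<pi>"
  assumes \<pi>: "prime_elem \<pi>" and m: "m > 0" and q: "Polynomial.degree q \<ge> 3"
    and u0: "t ^ m * u \<in> regular_at \<pi>" "inverse (t ^ m * u) \<in> regular_at \<pi>" "u \<noteq> 0"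
  shows "t ^ (m + 1) * rf_eval_x u q \<notin> regular_at \<pi>"
proof
  assume G: "t ^ (m + 1) * rf_eval_x u q \<in> regular_at \<pi>"
  define N where "N = Polynomial.degree q"
  define s where "s = t ^ m * u"
  note intros = regular_at_add[OF \<pi>] regular_at_mult[OF \<pi>] regular_at_diff[OF \<pi>]
    regular_at_power[OF \<pi>] regular_at_sum[OF \<pi>] to_fract_regular[OF \<pi>]
  have t: "t \<in> regular_at \<pi>" unfolding t_def by (rule intros)
  have const: "rf_const c \<in> regular_at \<pi>" for c unfolding rf_const_def by (rule intros)
  have s: "s \<in> regular_at \<pi>" "inverse s \<in> regular_at \<pi>" "s \<noteq> 0"
    using u0 \<pi> by (auto simp: s_def t_def)
  define R where "R = (\<Sum>i<N. rf_const (coeff q i) * s ^ i * t ^ (m * (N - i) - 1))"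
  have "R \<in> regular_at \<pi>" unfolding R_def by (intro intros const s t)
  have summand: "t ^ (m * N) * (rf_const (coeff q i) * u ^ i) =
      t * (rf_const (coeff q i) * s ^ i * t ^ (m * (N - i) - 1))" if "i < N" for i
  proof -
    have "m * N = m * i + Suc (m * (N - i) - 1)"
    proof -
      have "m * N = m * i + m * (N - i)" using that by (simp flip: distrib_left)
      moreover have "m * (N - i) > 0" using that m by simp
      ultimately show ?thesis by simp
    qed
    hence "t ^ (m * N) = (t ^ m) ^ i * (t * t ^ (m * (N - i) - 1))"
      by (metis power_add power_mult power_Suc)
    thus ?thesis by (simp add: s_def power_mult_distrib mult_ac)
  qed
  have "t ^ (m * N) * rf_eval_x u q =
      (\<Sum>i<N. t ^ (m * N) * (rf_const (coeff q i) * u ^ i)) + t ^ (m * N) * (rf_const (coeff q N) * u ^ N)"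
    unfolding rf_eval_x_sum N_def[symmetric] by (simp add: sum_distrib_left distrib_left flip: lessThan_Suc_atMost)
  also have "\<dots> = t * R + rf_const (coeff q N) * s ^ N"
  proof -
    have "(\<Sum>i<N. t ^ (m * N) * (rf_const (coeff q i) * u ^ i)) = t * R"
      unfolding R_def sum_distrib_left by (intro sum.cong refl summand) simp
    moreover have "t ^ (m * N) * (rf_const (coeff q N) * u ^ N) = rf_const (coeff q N) * s ^ N"
      unfolding s_def power_mult[of t m N] power_mult_distrib by (simp only: mult_ac)
    ultimately show ?thesis by simp
  qed
  finally have 1: "t ^ (m * N) * rf_eval_x u q = t * R + rf_const (coeff q N) * s ^ N" .
  \<comment> \<open>Here the degree bound is essential: m N >= m + 2 leaves a spare factor
    \<open>t\<close> beyond \<open>t ^ (m + 1)\<close>. With N = 2 and m = 1 there would be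
    none.\<close>
  have "3 * m \<le> m * N" using q by (simp add: N_def)
  hence "m * N = Suc (m * N - m - 2) + (m + 1)" using m by linarith
  hence "t ^ (m * N) = t * t ^ (m * N - m - 2) * t ^ (m + 1)"
    by (metis power_add power_Suc)
  hence 2: "t ^ (m * N) * rf_eval_x u q = t * (t ^ (m * N - m - 2) * (t ^ (m + 1) * rf_eval_x u q))"
    by (simp only: mult_ac)
  define c where "c = coeff q N"
  have c: "c \<noteq> 0" using q by (auto simp: c_def N_def)
  have "t * (t ^ (m * N - m - 2) * (t ^ (m + 1) * rf_eval_x u q) - R) = rf_const c * s ^ N"
    using 1 2 by (simp only: right_diff_distrib c_def add_diff_cancel_left')
  \<comment> \<open>Multiplying by the inverse of the unit \<open>rf_const c * s ^ N\<close>
    exhibits a regular inverse of \<open>t\<close>.\<close>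
  hence "t * ((t ^ (m * N - m - 2) * (t ^ (m + 1) * rf_eval_x u q) - R) * (rf_const (inverse c) * inverse s ^ N)) =
      rf_const c * s ^ N * (rf_const (inverse c) * inverse s ^ N)"
    by (simp only: mult.assoc[symmetric])
  also have "\<dots> = rf_const (c * inverse c) * (s * inverse s) ^ N"
    by (simp only: rf_const_simps power_mult_distrib mult_ac)
  also have "\<dots> = 1" using c s by simp
  finally show False
    using prime_times_regular_not_unit[OF \<pi>] G t s \<open>R \<in> _\<close> const unfolding t_def[symmetric]
    by (metis intros(2,3,4))
qed

text \<open>A prime in the denominator that does not divide the numerator is a true pole, where
  \<open>rf_eval_x_pole\<close> contradicts \<open>jacobian_pole_bound\<close>. So the prime factors
  of the denominator can be cancelled one after another.\<close>

theorem poisson_solution_no_pole: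
  fixes u v :: "'k :: field ratfun2"
  assumes v: "v \<noteq> 0" and q: "Polynomial.degree q \<ge> 3"
    and eq: "jacobian u v * (rf_of_poly_x q * rf_Y) = rf_eval_x u q * v"
  shows "u \<in> range to_fract"
proof -
  have no_pole: "\<pi> dvd a" if \<pi>: "prime_elem \<pi>" and u: "u = Fract a (\<pi> * b)" and b: "b \<noteq> 0" for \<pi> a b
  proof (rule ccontr)
    assume a: "\<not> \<pi> dvd a"
    define t where "t = to_fract \<pi>"
    have t0: "t \<noteq> 0" using \<pi> by (auto simp: t_def)
    have "\<pi> * b \<noteq> 0" using b \<pi> by auto
    then obtain m d where d: "\<pi> * b = \<pi> ^ m * d" "\<not> \<pi> dvd d" using ufd_prime_decompose[OF \<pi>] by blast
    have m: "m > 0" using d by (cases m) (auto simp: dvd_def)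
    have d0: "d \<noteq> 0" using d by auto
    have tu: "t ^ m * u = Fract a d"
      using t0 d0 unfolding u d t_def by (simp add: Fract_conv_to_fract to_fract_hom.hom_power)
    obtain n v0 where v0: "v = t powi n * v0" "v0 \<in> regular_at \<pi>" "inverse v0 \<in> regular_at \<pi>" "v0 \<noteq> 0"
      unfolding t_def by (rule prime_power_decompose[OF \<pi> v])
    \<comment> \<open>The logarithmic derivative of a product splits: the power of \<open>t\<close>
      gives the simple pole, the unit \<open>v0\<close> a regular term.\<close>
    have log: "D v / v = of_int n * D t / t + D v0 * inverse v0" if "field_derivation D" for D
    proof -
      interpret D: field_derivation D by fact
      have "D v / v = D (t powi n) / t powi n + D v0 / v0"
        unfolding v0(1) D.mult using t0 v0(4) by (simp add: add_divide_distrib)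
      also have "D (t powi n) / t powi n = of_int n * D t / t"
        using D.power_int[OF t0, of n] t0 by (simp add: frac_eq_eq mult_ac)
      finally show ?thesis by (simp add: divide_inverse)
    qed
    have qY: "rf_of_poly_x q * rf_Y \<in> regular_at \<pi>"
      unfolding rf_of_poly_x_def rf_Y_def by (intro regular_at_mult[OF \<pi>] to_fract_regular[OF \<pi>])
    note dx = rf_dx_regular[OF \<pi>] and dy = rf_dy_regular[OF \<pi>]
    have "t ^ (m + 1) * (jacobian u v / v) \<in> regular_at \<pi>"
      unfolding t_def
    proof (rule jacobian_pole_bound[OF \<pi>])
      show "to_fract \<pi> ^ m * u \<in> regular_at \<pi>"
        using tu d by (simp add: t_def regular_atI)
      show "rf_dx v / v = of_int n * rf_dx (to_fract \<pi>) / to_fract \<pi> + rf_dx v0 * inverse v0"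
        using log[OF rf_dx.field_derivation_axioms] by (simp add: t_def)
      show "rf_dy v / v = of_int n * rf_dy (to_fract \<pi>) / to_fract \<pi> + rf_dy v0 * inverse v0"
        using log[OF rf_dy.field_derivation_axioms] by (simp add: t_def)
    qed (intro regular_at_mult[OF \<pi>] dx dy v0 rf_dx.field_derivation_axioms rf_dy.field_derivation_axioms | assumption)+
    hence "t ^ (m + 1) * (jacobian u v / v) * (rf_of_poly_x q * rf_Y) \<in> regular_at \<pi>"
      by (rule regular_at_mult[OF \<pi> _ qY])
    also have "t ^ (m + 1) * (jacobian u v / v) * (rf_of_poly_x q * rf_Y) =
        t ^ (m + 1) * (jacobian u v * (rf_of_poly_x q * rf_Y)) / v"
      by (simp add: mult.assoc)
    also have "\<dots> = t ^ (m + 1) * rf_eval_x u q"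
      unfolding eq using v by simp
    finally have "t ^ (m + 1) * rf_eval_x u q \<in> regular_at \<pi>" .
    moreover have "u \<noteq> 0" using a unfolding u by (cases "a = 0") (use b \<pi> in \<open>auto simp: Zero_fract_def eq_fract\<close>)
    moreover have "inverse (t ^ m * u) \<in> regular_at \<pi>" "t ^ m * u \<in> regular_at \<pi>"
      unfolding tu using a d by (simp_all add: regular_atI)
    ultimately show False using rf_eval_x_pole[OF \<pi> m q] unfolding t_def by blast
  qed
  have reduce: "u \<in> range to_fract"
    if "\<And>f. f \<in># F \<Longrightarrow> irreducible f" "u = Fract a (prod_mset F)" for F a
    using that
  proof (induction F arbitrary: a)
    case empty
    thus ?case by (auto simp: to_fract_def)
  next
    case (add \<pi> F)
    have \<pi>: "prime_elem \<pi>" using add.prems by simp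
    have F0: "prod_mset F \<noteq> 0" using add.prems by (auto simp: prod_mset_zero_iff)
    have "\<pi> dvd a" using no_pole[OF \<pi> _ F0, of a] add.prems by simp
    then obtain c where "a = \<pi> * c" by (elim dvdE)
    hence "u = Fract c (prod_mset F)"
      using add.prems(2) \<pi> F0 by (auto simp: eq_fract prime_elem_def)
    thus ?case using add by simp
  qed
  obtain a b where ab: "u = Fract a b" "b \<noteq> 0" by (cases u) auto
  show ?thesis
  proof (cases "b dvd 1")
    case True
    then obtain c where c: "1 = b * c" by (elim dvdE)
    have "u = to_fract (a * c)" using ab c by (simp add: to_fract_def eq_fract mult_ac)
    thus ?thesis by blast
  next
    case False
    then obtain F where "mset_factors F b" using mset_factors_exist ab(2) by blast
    hence "\<And>f. f \<in># F \<Longrightarrow> irreducible f" "b = prod_mset F" by (simp_all add: mset_factors_def)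
    thus ?thesis using reduce[of F a] ab(1) by simp
  qed
qed

section \<open>Solutions of \<open>{u, v} = q(u) v\<close>\<close>

text \<open>Upper bounds replace exact degrees because the Euler operator y d/dy may lower the
  degree: it kills terms free of y.\<close>

lemma coeff_mult_top:
  fixes a b :: "'a :: comm_semiring_0 poly"
  assumes "Polynomial.degree a \<le> m" "Polynomial.degree b \<le> n"
  shows "coeff (a * b) (m + n) = coeff a m * coeff b n"
proof -
  have "coeff (a * b) (m + n) = (\<Sum>i\<le>m + n. coeff a i * coeff b (m + n - i))"
    by (simp add: coeff_mult)
  also have "\<dots> = (\<Sum>i\<in>{m}. coeff a i * coeff b (m + n - i))"
  proof (rule sum.mono_neutral_right)
    show "\<forall>i\<in>{..m + n} - {m}. coeff a i * coeff b (m + n - i) = 0"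
    proof
      fix i assume "i \<in> {..m + n} - {m}"
      hence "i > m \<or> m + n - i > n" by auto
      thus "coeff a i * coeff b (m + n - i) = 0"
        using assms by (auto simp: coeff_eq_0)
    qed
  qed auto
  finally show ?thesis by simp
qed

text \<open>The Euler operator y d/dy is diagonal on powers of y. Unlike d/dy it does not shift
  degrees, so top coefficients can be compared.\<close>

lemma coeff_y_pderiv: "coeff (pCons 0 (pderiv a)) i = of_nat i * coeff a i"
  by (cases i) (simp_all add: coeff_pderiv)

lemma degree_y_pderiv: "Polynomial.degree (pCons 0 (pderiv a)) \<le> Polynomial.degree a"
  by (rule degree_le) (simp add: coeff_y_pderiv coeff_eq_0)

lemma rf_eval_x_to_fract:
  "rf_eval_x (to_fract a) q = to_fract (pcompose (map_poly (\<lambda>c. [:c:]) q) a)"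
proof (induction q)
  case (pCons c q)
  thus ?case
    by (simp add: rf_eval_x_pCons rf_const_def coeff_lift_hom.map_poly_pCons_hom pcompose_pCons)
qed simp

lemma jacobian_to_fract_Fract:
  fixes a c e :: "'k :: field poly poly"
  assumes "e \<noteq> 0"
  shows "jacobian (to_fract a) (Fract c e) =
    to_fract (map_poly pderiv a * (pderiv c * e - c * pderiv e)
      - pderiv a * (map_poly pderiv c * e - c * map_poly pderiv e)) / to_fract (e * e)"
proof -
  have "r * (s / z) - t * (u / z) = (r * s - t * u) / z" for r s t u z :: "'k ratfun2"
    by (simp add: diff_divide_distrib)
  thus ?thesis
    unfolding rf_dx_to_fract rf_dy_to_fract rf_dx_Fract[OF assms] rf_dy_Fract[OF assms]
      Fract_conv_to_fract[of _ "e * e"] by (simp only: to_fract_diff to_fract_mult)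
qed

text \<open>The factor y of the bracket turns d/dy into the Euler operator. After clearing
  denominators the left side has y-degree at most deg a + m, the right side deg q deg a + m, so
  \<open>a\<close> is free of y. The coefficients of y^m then give the equation for
  \<open>g\<close>.\<close>

lemma poisson_solution_poly:
  fixes a c e :: "'k :: field_char_0 poly poly" and q :: "'k poly"
  assumes c: "c \<noteq> 0" and e: "e \<noteq> 0" and q: "Polynomial.degree q \<ge> 2"
    and eq: "jacobian (to_fract a) (Fract c e) * (rf_of_poly_x q * rf_Y) = rf_eval_x (to_fract a) q * Fract c e"
  obtains g n where "a = [:g:]" "pcompose q g = of_int n * (pderiv g * q)"
proof -
  define Q where "Q = pcompose (map_poly (\<lambda>c. [:c:]) q) a"
  define m where "m = Polynomial.degree c + Polynomial.degree e"
  define \<theta> where "\<theta> a = pCons 0 (pderiv a)" for a :: "'k poly poly"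
  define M where "M = (map_poly pderiv a * (pderiv c * e - c * pderiv e)
      - pderiv a * (map_poly pderiv c * e - c * map_poly pderiv e))"
  have "to_fract M / to_fract (e * e) * (to_fract [:q:] * to_fract [:0, 1:]) = to_fract Q * (to_fract c / to_fract e)"
    using eq unfolding jacobian_to_fract_Fract[OF e] rf_eval_x_to_fract Q_def[symmetric] M_def[symmetric]
    by (simp only: rf_of_poly_x_def rf_Y_def Fract_conv_to_fract)
  hence "to_fract (M * ([:q:] * [:0, 1:])) = to_fract (Q * c * e)"
    using e unfolding to_fract_mult by (simp add: field_simps)
  hence "M * ([:q:] * [:0, 1:]) = Q * c * e" by (simp only: to_fract_eq_iff)
  \<comment> \<open>Formal identity distributing the factor y over the y-derivatives, so that each
    \<open>pderiv\<close> becomes \<theta>.\<close>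
  moreover have "(r * (s * y * e - c * (t * y)) - u * y * z) * k = (r * (s * e - c * t) - u * z) * (k * y)"
    for r s t u y z k :: "'k poly poly"
    by (simp add: algebra_simps)
  moreover have "\<theta> b = pderiv b * [:0, 1:]" for b by (simp add: \<theta>_def)
  ultimately have main: "(map_poly pderiv a * (\<theta> c * e - c * \<theta> e)
      - \<theta> a * (map_poly pderiv c * e - c * map_poly pderiv e)) * [:q:] = Q * c * e"
    unfolding M_def by metis
  have deg_x: "Polynomial.degree (map_poly pderiv b) \<le> Polynomial.degree b" for b :: "'k poly poly"
    by (rule degree_map_poly_le)
  have deg_y: "Polynomial.degree (\<theta> b) \<le> Polynomial.degree b" for b :: "'k poly poly"
    unfolding \<theta>_def by (rule degree_y_pderiv)
  note deg_mult = order.trans[OF degree_mult_le add_mono]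
  have deg_c: "Polynomial.degree (\<theta> c * e) \<le> m" "Polynomial.degree (c * \<theta> e) \<le> m"
    "Polynomial.degree (map_poly pderiv c * e) \<le> m" "Polynomial.degree (c * map_poly pderiv e) \<le> m"
    unfolding m_def by (intro deg_mult deg_x deg_y order.refl)+
  have deg_Q: "Polynomial.degree Q = Polynomial.degree q * Polynomial.degree a"
    unfolding Q_def by (simp add: degree_pcompose)
  have "Polynomial.degree a = 0"
  proof (rule ccontr)
    assume a: "Polynomial.degree a \<noteq> 0"
    hence "Polynomial.degree Q \<noteq> 0" using deg_Q q by simp
    hence "Q \<noteq> 0" by auto
    hence "Polynomial.degree (Q * c * e) = Polynomial.degree q * Polynomial.degree a + m"
      using c e deg_Q by (simp add: degree_mult_eq m_def)
    moreover have "Polynomial.degree (map_poly pderiv a * (\<theta> c * e - c * \<theta> e)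
      - \<theta> a * (map_poly pderiv c * e - c * map_poly pderiv e)) \<le> Polynomial.degree a + m"
      by (intro degree_diff_le deg_mult deg_x deg_y deg_c)
    hence "Polynomial.degree ((map_poly pderiv a * (\<theta> c * e - c * \<theta> e)
      - \<theta> a * (map_poly pderiv c * e - c * map_poly pderiv e)) * [:q:]) \<le> (Polynomial.degree a + m) + 0"
      by (rule deg_mult) simp
    ultimately have "Polynomial.degree q * Polynomial.degree a \<le> Polynomial.degree a"
      unfolding main by simp
    with a q show False by simp
  qed
  then obtain g where a: "a = [:g:]" by (auto elim: degree_eq_zeroE)
  define \<gamma> where "\<gamma> = lead_coeff c * lead_coeff e"
  have \<gamma>: "\<gamma> \<noteq> 0" using c e by (simp add: \<gamma>_def)
  \<comment> \<open>The Euler operator multiplies the leading terms of \<open>c\<close> and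
    \<open>e\<close> by their y-degrees; the difference remains in the numerator of the quotient
    rule.\<close>
  define n where "n = int (Polynomial.degree c) - int (Polynomial.degree e)"
  have Q: "Q = [:pcompose q g:]"
    by (simp add: Q_def a pcompose_pCons_0 pcompose_altdef)
  have "coeff (\<theta> c * e - c * \<theta> e) m = of_int n * \<gamma>"
    unfolding m_def coeff_diff
      \<theta>_def coeff_mult_top[OF degree_y_pderiv order.refl] coeff_mult_top[OF order.refl degree_y_pderiv]
      coeff_y_pderiv
    by (simp add: n_def \<gamma>_def algebra_simps)
  moreover have "coeff (c * e) m = \<gamma>"
    by (simp add: m_def \<gamma>_def coeff_mult_degree_sum)
  moreover have "smult (pderiv g * q) (\<theta> c * e - c * \<theta> e) = smult (pcompose q g) (c * e)"
    using main unfolding Q a by (simp add: \<theta>_def mult.commute)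
  hence "coeff (smult (pderiv g * q) (\<theta> c * e - c * \<theta> e)) m = coeff (smult (pcompose q g) (c * e)) m"
    by (rule arg_cong)
  ultimately have "pderiv g * q * (of_int n * \<gamma>) = pcompose q g * \<gamma>" by simp
  hence "pcompose q g * \<gamma> = of_int n * (pderiv g * q) * \<gamma>" by (simp only: mult_ac)
  hence "pcompose q g = of_int n * (pderiv g * q)" using \<gamma> by (metis mult_right_cancel)
  with a show thesis by (rule that)
qed

text \<open>With N = deg q and D = deg g, degrees give N D = D - 1 + N, that is, (N - 1) (D - 1) =
  0.\<close>

lemma pcompose_eq_pderiv_mult_degree:
  fixes g q :: "'k :: field_char_0 poly"
  assumes eq: "pcompose q g = of_int n * (pderiv g * q)" and g: "Polynomial.degree g \<noteq> 0"
    and q: "Polynomial.degree q \<ge> 2"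
  shows "Polynomial.degree g = 1" "n \<noteq> 0"
proof -
  have deg: "Polynomial.degree (pcompose q g) = Polynomial.degree q * Polynomial.degree g"
    by (rule degree_pcompose)
  have nz: "pcompose q g \<noteq> 0"
  proof
    assume "pcompose q g = 0"
    hence "Polynomial.degree q * Polynomial.degree g = 0" using deg by simp
    with g q show False by simp
  qed
  thus n: "n \<noteq> 0" using eq by auto
  have "Polynomial.degree (pcompose q g) = Polynomial.degree (smult (of_int n) (pderiv g * q))"
    unfolding eq by (simp add: of_int_poly)
  also have "\<dots> = Polynomial.degree g - 1 + Polynomial.degree q"
    using n nz eq by (auto simp: degree_mult_eq degree_pderiv)
  finally have "Polynomial.degree q * Polynomial.degree g + 1 = Polynomial.degree g + Polynomial.degree q"
    using deg g by simp
  hence "(int (Polynomial.degree q) - 1) * (int (Polynomial.degree g) - 1) = 0"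
    by (simp add: algebra_simps flip: of_nat_mult of_nat_add)
  with q show "Polynomial.degree g = 1" by auto
qed

text \<open>A nonzero a/b with vanishing y-derivative has numerator and denominator of equal
  y-degree. Subtracting the ratio \<open>h\<close> of their leading coefficients keeps the
  derivative zero but lowers the degree of the numerator, so the difference must be 0.\<close>

lemma rf_dy_eq_0:
  fixes w :: "'k :: field_char_0 ratfun2"
  assumes "rf_dy w = 0"
  shows "w \<in> range rf_of_x"
proof -
  have deg: "Polynomial.degree a = Polynomial.degree b"
    if "rf_dy (Fract a b) = 0" "a \<noteq> 0" "b \<noteq> 0" for a b :: "'k poly poly"
  proof -
    have "pderiv a * b = a * pderiv b"
      using that by (simp add: rf_dy_Fract Zero_fract_def eq_fract)
    hence "pCons 0 (pderiv a) * b = a * pCons 0 (pderiv b)" by simp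
    moreover have "coeff (pCons 0 (pderiv a) * b) (Polynomial.degree a + Polynomial.degree b) =
        of_nat (Polynomial.degree a) * (lead_coeff a * lead_coeff b)"
      unfolding coeff_mult_top[OF degree_y_pderiv order.refl] coeff_y_pderiv by (simp only: mult_ac)
    moreover have "coeff (a * pCons 0 (pderiv b)) (Polynomial.degree a + Polynomial.degree b) =
        of_nat (Polynomial.degree b) * (lead_coeff a * lead_coeff b)"
      unfolding coeff_mult_top[OF order.refl degree_y_pderiv] coeff_y_pderiv by (simp only: mult_ac)
    ultimately show ?thesis using that by simp
  qed
  obtain a b where w: "w = Fract a b" "b \<noteq> 0" by (cases w) auto
  show ?thesis
  proof (cases "a = 0")
    case True
    hence "w = rf_of_x 0" by (simp add: w Fract_conv_to_fract)
    thus ?thesis by blast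
  next
    case a: False
    define \<alpha> \<beta> where "\<alpha> = lead_coeff a" and "\<beta> = lead_coeff b"
    have \<beta>: "\<beta> \<noteq> 0" using w by (simp add: \<beta>_def)
    define h where "h = rf_of_x (to_fract \<alpha> / to_fract \<beta>)"
    have h: "h = to_fract [:\<alpha>:] / to_fract [:\<beta>:]"
      by (simp add: h_def rf_of_x.hom_div rf_of_poly_x_def)
    define d where "d = [:\<beta>:] * a - [:\<alpha>:] * b"
    have wh: "w - h = Fract d ([:\<beta>:] * b)"
      using w \<beta> by (simp add: h d_def diff_frac_eq eq_fract flip: Fract_conv_to_fract)
    have "rf_dy h = 0"
      using \<beta> by (simp add: h rf_dy.divide rf_dy_to_fract)
    hence dwh: "rf_dy (Fract d ([:\<beta>:] * b)) = 0"
      using assms unfolding wh[symmetric] rf_dy.diff by simp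
    have ab: "Polynomial.degree a = Polynomial.degree b"
      using deg assms a w by simp
    have "d = 0"
    proof (rule ccontr)
      assume d: "d \<noteq> 0"
      have "Polynomial.degree d = Polynomial.degree ([:\<beta>:] * b)"
        by (rule deg[OF dwh d]) (use \<beta> w in simp)
      hence "Polynomial.degree d = Polynomial.degree b" using \<beta> by simp
      moreover have "coeff d (Polynomial.degree b) = 0"
        by (simp add: d_def \<alpha>_def \<beta>_def ab mult.commute)
      ultimately show False using d by (metis leading_coeff_0_iff)
    qed
    hence "w = h" using wh by (simp add: Zero_fract_def[symmetric] Fract_conv_to_fract)
    thus ?thesis unfolding h_def by blast
  qed
qed

lemma solution_of_euler_equation:
  fixes v :: "'k :: field_char_0 ratfun2"
  assumes "rf_Y * rf_dy v = of_int n * v"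
  obtains h where "v = rf_of_x h * rf_Y powi n"
proof -
  define w where "w = v * rf_Y powi (- n)"
  have "rf_Y * rf_dy w = rf_Y * rf_dy v * rf_Y powi (- n) + v * (rf_Y * rf_dy (rf_Y powi (- n)))"
    by (simp add: w_def rf_dy.mult algebra_simps)
  also have "\<dots> = 0"
    unfolding assms rf_dy.power_int[OF rf_Y_nz] by simp
  finally have "rf_dy w = 0" by simp
  then obtain h where "w = rf_of_x h" using rf_dy_eq_0 by blast
  hence "v = rf_of_x h * rf_Y powi n"
    by (simp add: w_def power_int_minus field_simps)
  thus thesis by (rule that)
qed

section \<open>The Poisson automorphisms\<close>

lemma rf_of_poly_x_pCons: "rf_of_poly_x (pCons c q) = rf_const c + rf_X * rf_of_poly_x q"
  by (simp add: rf_eval_x_pCons flip: rf_eval_x_X)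

lemma rf_eval_x_rf_of_poly_x: "rf_eval_x (rf_of_poly_x g) q = rf_of_poly_x (pcompose q g)"
proof -
  interpret R: inj_idom_hom "rf_of_poly_x :: 'a poly \<Rightarrow> _" by (rule rf_of_poly_x_hom)
  show ?thesis
    by (induction q)
      (simp_all add: rf_eval_x_pCons pcompose_pCons R.hom_add R.hom_mult, simp add: rf_of_poly_x_def rf_const_def)
qed

lemma rf_of_poly_x_linear: "rf_of_poly_x [:b, a:] = rf_const a * rf_X + rf_const b"
  by (simp add: add.commute flip: rf_eval_x_X)

lemma rf_of_poly_x_0 [simp]: "rf_of_poly_x 0 = 0"
  by (simp add: rf_of_poly_x_def)

lemma rf_of_poly_x_const [simp]: "rf_of_poly_x [:c:] = rf_const c"
  by (simp add: rf_of_poly_x_def rf_const_def)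

lemma rf_dx_of_poly_x: "rf_dx (rf_of_poly_x g) = rf_of_poly_x (pderiv g)"
  by (simp add: rf_of_poly_x_def rf_dx_to_fract)

lemma rf_dy_of_poly_x [simp]: "rf_dy (rf_of_poly_x g) = 0"
  by (simp add: rf_of_poly_x_def rf_dy_to_fract)

lemma rf_of_x_Fract: "rf_of_x (Fract c e) = rf_of_poly_x c / rf_of_poly_x e"
  by (simp add: Fract_conv_to_fract rf_of_x.hom_div)

lemma rf_of_poly_x_eq_0 [simp]: "rf_of_poly_x c = 0 \<longleftrightarrow> c = 0"
  by (simp add: rf_of_poly_x_def)

lemma rf_of_poly_x_eq_iff [simp]: "rf_of_poly_x c = rf_of_poly_x e \<longleftrightarrow> c = e"
  by (simp add: rf_of_poly_x_def)

lemma rf_dy_of_x [simp]: "rf_dy (rf_of_x w) = 0"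
proof -
  obtain c e where "w = Fract c e" "e \<noteq> 0" by (cases w) auto
  thus ?thesis by (simp add: rf_of_x_Fract rf_dy.divide)
qed

lemma monomial_euler:
  fixes n :: int
  shows "rf_Y * rf_dy (rf_of_x h * rf_Y powi n) = of_int n * (rf_of_x h * rf_Y powi n)"
proof -
  have "rf_Y * rf_dy (rf_of_x h * rf_Y powi n) = rf_of_x h * (rf_Y * rf_dy (rf_Y powi n))"
    by (simp add: rf_dy.mult)
  thus ?thesis by (simp add: rf_dy.power_int)
qed

lemma poisson_auts_comp: "\<phi> \<in> poisson_auts f \<Longrightarrow> \<psi> \<in> poisson_auts f \<Longrightarrow> \<phi> \<circ> \<psi> \<in> poisson_auts f"
  by (simp add: poisson_auts_def bij_comp)

lemma poisson_auts_id: "id \<in> poisson_auts f"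
  by (simp add: poisson_auts_def)

lemma poisson_auts_inv:
  assumes "\<phi> \<in> poisson_auts f"
  shows "inv_into UNIV \<phi> \<in> poisson_auts f" "inv_into UNIV \<phi> \<circ> \<phi> = id" "\<phi> \<circ> inv_into UNIV \<phi> = id"
proof -
  have bij: "bij \<phi>" using assms by (simp add: poisson_auts_def)
  show "inv_into UNIV \<phi> \<circ> \<phi> = id" "\<phi> \<circ> inv_into UNIV \<phi> = id"
    using bij by (simp_all add: bij_is_inj bij_is_surj flip: surj_iff)
  have inv: "\<phi> (inv_into UNIV \<phi> w) = w" for w using bij by (simp add: bij_is_surj surj_f_inv_f)
  have eqI: "inv_into UNIV \<phi> u = v" if "u = \<phi> v" for u v
    using that bij by (simp add: bij_is_inj)
  show "inv_into UNIV \<phi> \<in> poisson_auts f"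
    using assms bij unfolding poisson_auts_def
    by (auto simp: bij_imp_bij_inv inv intro!: eqI)
qed

text \<open>Together with \<open>rf_dy_eq_0\<close>: if the image of x is free of y, then k(x) is
  mapped into itself.\<close>

lemma (in ratfun2_hom) rf_dy_hom_of_x:
  assumes "rf_dy (\<phi> rf_X) = 0"
  shows "rf_dy (\<phi> (rf_of_x h)) = 0"
  using chain_rule[OF rf_dy.field_derivation_axioms rf_dy_simps(1), of "rf_of_x h"] assms by simp

lemma poisson_aut_form:
  fixes q :: "'k :: field_char_0 poly"
  assumes q: "Polynomial.degree q \<ge> 3" and \<phi>: "\<phi> \<in> poisson_auts (rf_of_poly_x q * rf_Y)"
  obtains a b h and n :: int where "a \<noteq> 0" "h \<noteq> 0" "\<phi> rf_X = rf_of_poly_x [:- b, a:]"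
    "\<phi> rf_Y = rf_of_x h * rf_Y powi n" "pcompose q [:- b, a:] = smult (of_int n * a) q"
proof -
  define u v where "u = \<phi> rf_X" and "v = \<phi> rf_Y"
  interpret ratfun2_hom \<phi> using \<phi> by (simp add: poisson_auts_iff)
  have v: "v \<noteq> 0" by (simp add: v_def)
  have "poisson_bracket (rf_of_poly_x q * rf_Y) u v = \<phi> (rf_of_poly_x q * rf_Y)"
    using \<phi> by (simp add: poisson_auts_iff u_def v_def)
  also have "\<dots> = rf_eval_x u q * v"
    by (simp add: u_def v_def mult hom_rf_eval_x flip: rf_eval_x_X)
  finally have eq: "jacobian u v * (rf_of_poly_x q * rf_Y) = rf_eval_x u q * v"
    by (simp add: poisson_bracket_def)
  obtain A where A: "u = to_fract A"
    using poisson_solution_no_pole[OF v q eq] by blast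
  obtain c e where ce: "v = Fract c e" "e \<noteq> 0" by (cases v) auto
  have c: "c \<noteq> 0" using v ce by (auto simp: Fract_conv_to_fract)
  obtain g n where g: "A = [:g:]" "pcompose q g = of_int n * (pderiv g * q)"
    using poisson_solution_poly[OF c ce(2) _ eq[unfolded A ce(1)]] q by auto
  have u: "u = rf_of_poly_x g" by (simp add: A g rf_of_poly_x_def)
  \<comment> \<open>A constant image of x would contradict injectivity, as constants are already
    fixed.\<close>
  have "Polynomial.degree g \<noteq> 0"
  proof
    assume "Polynomial.degree g = 0"
    then obtain s where "g = [:s:]" by (auto elim: degree_eq_zeroE)
    hence "\<phi> rf_X = \<phi> (rf_const s)" using u by (simp add: u_def)
    hence "rf_X = rf_const s" by (rule injD[OF inj])
    hence "rf_dx rf_X = rf_dx (rf_const s)" by simp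
    thus False by simp
  qed
  hence deg: "Polynomial.degree g = 1"
    using pcompose_eq_pderiv_mult_degree(1)[OF g(2)] q by simp
  then obtain a b where ab: "g = [:- b, a:]" "a \<noteq> 0"
  proof -
    obtain c r where g: "g = pCons c r" by (cases g)
    with deg have "Polynomial.degree r = 0" "r \<noteq> 0" by (auto split: if_splits)
    then obtain a where "r = [:a:]" "a \<noteq> 0" by (auto elim: degree_eq_zeroE)
    thus thesis using that[of "- c" a] g by simp
  qed
  have pd: "pderiv g = [:a:]" by (simp add: ab pderiv_pCons)
  hence comp: "pcompose q g = smult (of_int n * a) q" using g(2) by (simp add: of_int_poly mult.commute)
  have "rf_const a * rf_of_poly_x q * (rf_Y * rf_dy v) = rf_eval_x u q * v"
    using eq by (simp add: u rf_dx_of_poly_x pd mult_ac)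
  also have "rf_eval_x u q = rf_const a * rf_of_poly_x q * of_int n"
    unfolding u rf_eval_x_rf_of_poly_x comp
    by (simp add: rf_of_poly_x_def rf_const_def mult_ac flip: rf_const_of_int to_fract_mult)
  finally have "rf_Y * rf_dy v = of_int n * v"
    using ab(2) q by auto
  then obtain h where h: "v = rf_of_x h * rf_Y powi n" by (rule solution_of_euler_equation)
  have "h \<noteq> 0" using h v by auto
  with ab comp h u show thesis by (intro that[of a h b n]) (auto simp: u_def v_def)
qed

text \<open>The inverse sends y to h' y^m for some m. Applying \<phi> gives y = z v^m with z free of
  y, and the logarithmic Euler derivative of this equation reads 1 = m n.\<close>

lemma poisson_aut_exponent:
  fixes q :: "'k :: field_char_0 poly"
  assumes q: "Polynomial.degree q \<ge> 3" and \<phi>: "\<phi> \<in> poisson_auts (rf_of_poly_x q * rf_Y)"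
    and X: "rf_dy (\<phi> rf_X) = 0" and Y: "\<phi> rf_Y = rf_of_x h * rf_Y powi n"
  shows "n \<in> {1, -1}"
proof -
  interpret ratfun2_hom \<phi> using \<phi> by (simp add: poisson_auts_iff)
  obtain h' m where m: "inv_into UNIV \<phi> rf_Y = rf_of_x h' * rf_Y powi m"
    using poisson_aut_form[OF q poisson_auts_inv(1)[OF \<phi>]] by metis
  define v z where "v = \<phi> rf_Y" and "z = \<phi> (rf_of_x h')"
  have v: "v \<noteq> 0" by (simp add: v_def)
  have "rf_Y = \<phi> (inv_into UNIV \<phi> rf_Y)" using poisson_auts_inv(3)[OF \<phi>] by (metis comp_apply id_apply)
  hence Y_eq: "rf_Y = z * v powi m" by (simp add: m mult power_int v_def z_def)
  have dz: "rf_dy z = 0" unfolding z_def by (rule rf_dy_hom_of_x[OF X])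
  have dv: "rf_Y * rf_dy v = of_int n * v" unfolding v_def Y by (rule monomial_euler)
  have "v * (rf_Y * rf_dy (z * v powi m)) = z * rf_Y * (v * rf_dy (v powi m))"
    by (simp add: rf_dy.mult dz)
  also have "\<dots> = z * of_int m * v powi m * (rf_Y * rf_dy v)"
    by (simp add: rf_dy.power_int[OF v])
  also have "\<dots> = v * (of_int (m * n) * (z * v powi m))"
    by (simp add: dv)
  finally have "rf_Y * rf_dy rf_Y = of_int (m * n) * (rf_Y :: 'k ratfun2)"
    using v unfolding Y_eq[symmetric] mult_cancel_left by blast
  hence "of_int (m * n) = (1 :: 'k ratfun2)" by simp
  hence "rf_const (of_int (m * n) :: 'k) = rf_const 1" by simp
  hence "(of_int (m * n) :: 'k) = of_int 1" by (metis rf_const.eq_iff of_int_1)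
  hence "m * n = 1" by (simp only: of_int_eq_iff)
  thus ?thesis by (auto simp: zmult_eq_1_iff)
qed

text \<open>k(x) is generated as a field by k and x; applied below to the image of a homomorphism
  and to the elements it fixes.\<close>

lemma rf_of_x_in_subfield:
  assumes "\<And>c. rf_const c \<in> S" "rf_X \<in> S" "\<And>u v. u \<in> S \<Longrightarrow> v \<in> S \<Longrightarrow> u + v \<in> S"
    "\<And>u v. u \<in> S \<Longrightarrow> v \<in> S \<Longrightarrow> u * v \<in> S" "\<And>u. u \<in> S \<Longrightarrow> inverse u \<in> S"
  shows "rf_of_x w \<in> S"
proof -
  have poly: "rf_of_poly_x c \<in> S" for c
    by (induction c) (use assms(1)[of 0] in \<open>auto simp: rf_of_poly_x_pCons intro!: assms\<close>)
  obtain c e where "w = Fract c e" "e \<noteq> 0" by (cases w) auto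
  thus ?thesis by (auto simp: rf_of_x_Fract divide_inverse intro!: assms poly)
qed

definition aut_of :: "'k :: field_char_0 \<Rightarrow> 'k \<Rightarrow> int \<Rightarrow> 'k poly fract \<Rightarrow> 'k ratfun2 \<Rightarrow> 'k ratfun2" where
  "aut_of a b e h = rf_subst (rf_of_poly_x [:- b, a:]) (rf_of_x h * rf_Y powi e)"

text \<open>Since y J(u, v) = a e v is nonzero, the substitution exists. Its image is a subfield
  containing x, hence k(x), hence y^e and y, so it is bijective. The last clause is the bracket
  equation for this pair.\<close>

lemma aut_of:
  fixes q :: "'k :: field_char_0 poly"
  assumes a: "a \<noteq> 0" and h: "h \<noteq> 0" and e: "e \<in> {1, -1}"
  shows "ratfun2_hom (aut_of a b e h)" "aut_of a b e h rf_X = rf_of_poly_x [:- b, a:]"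
    "aut_of a b e h rf_Y = rf_of_x h * rf_Y powi e"
    "pcompose q [:- b, a:] = smult (of_int e * a) q \<Longrightarrow> aut_of a b e h \<in> poisson_auts (rf_of_poly_x q * rf_Y)"
proof -
  define u v where "u = rf_of_poly_x [:- b, a:]" and "v = rf_of_x h * rf_Y powi e"
  define \<phi> where "\<phi> = aut_of a b e h"
  have e0: "of_int e \<noteq> (0 :: 'k ratfun2)" using e by auto
  have v0: "v \<noteq> 0" using h by (simp add: v_def)
  have dv: "rf_Y * rf_dy v = of_int e * v" unfolding v_def by (rule monomial_euler)
  have J: "rf_Y * jacobian u v = rf_const a * of_int e * v"
  proof -
    have "rf_Y * jacobian u v = rf_const a * (rf_Y * rf_dy v)"
      by (simp add: u_def rf_dx_of_poly_x pderiv_pCons mult_ac)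
    thus ?thesis by (simp add: dv)
  qed
  hence "jacobian u v \<noteq> 0" using a e0 v0 by auto
  note subst = rf_subst[OF this]
  show hom: "ratfun2_hom (aut_of a b e h)" and X: "aut_of a b e h rf_X = rf_of_poly_x [:- b, a:]"
    and Y: "aut_of a b e h rf_Y = rf_of_x h * rf_Y powi e"
    using subst by (simp_all add: aut_of_def u_def v_def)
  interpret ratfun2_hom \<phi> unfolding \<phi>_def by (rule hom)
  have inv_range: "inverse w \<in> range \<phi>" if "w \<in> range \<phi>" for w
    using that by (auto simp flip: hom_inverse)
  have add_range: "w + z \<in> range \<phi>" "w * z \<in> range \<phi>" if "w \<in> range \<phi>" "z \<in> range \<phi>" for w z
    using that by (auto simp flip: add mult)
  have const_range: "rf_const c \<in> range \<phi>" for c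
    using const by (metis rangeI)
  \<comment> \<open>The witness (x + b) / a is the inverse of the affine map a x - b.\<close>
  have "\<phi> (rf_of_poly_x [:b / a, 1 / a:]) = rf_X"
  proof -
    have "\<phi> (rf_of_poly_x [:b / a, 1 / a:]) = rf_const (1 / a * a) * rf_X + rf_const (b / a - 1 / a * b)"
      unfolding rf_of_poly_x_linear add mult const X[folded \<phi>_def] diff_conv_add_uminus rf_const_simps
      by (simp add: algebra_simps)
    thus ?thesis using a by simp
  qed
  hence X_range: "rf_X \<in> range \<phi>" by (metis rangeI)
  note of_x_range = rf_of_x_in_subfield[of "range \<phi>", OF const_range X_range add_range inv_range]
  have "\<phi> rf_Y * inverse (rf_of_x h) \<in> range \<phi>"
    by (intro add_range inv_range of_x_range rangeI)
  also have "\<phi> rf_Y * inverse (rf_of_x h) = rf_Y powi e"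
    using h Y by (simp add: \<phi>_def field_simps)
  finally have "rf_Y powi e \<in> range \<phi>" .
  hence Y_range: "rf_Y \<in> range \<phi>" using e inv_range[of "inverse rf_Y"] by (auto simp: power_int_minus)
  have "w \<in> range \<phi>" for w
    by (induction w rule: ratfun2_induct) (intro const_range X_range Y_range add_range inv_range; assumption)+
  hence bij: "bij \<phi>" using inj by (auto simp: bij_def)
  show "aut_of a b e h \<in> poisson_auts (rf_of_poly_x q * rf_Y)"
    if comp: "pcompose q [:- b, a:] = smult (of_int e * a) q"
  proof -
    have "poisson_bracket (rf_of_poly_x q * rf_Y) u v = rf_of_poly_x q * (rf_Y * jacobian u v)"
      by (simp add: poisson_bracket_def)
    also have "\<dots> = rf_const a * of_int e * rf_of_poly_x q * v"
      unfolding J by simp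
    also have "rf_const a * of_int e * rf_of_poly_x q = rf_of_poly_x (smult (of_int e * a) q)"
      by (simp add: rf_of_poly_x_def rf_const_def mult_ac flip: rf_const_of_int to_fract_mult)
    also have "\<dots> * v = rf_eval_x u q * v"
      unfolding comp[symmetric] u_def rf_eval_x_rf_of_poly_x ..
    also have "\<dots> = \<phi> (rf_of_poly_x q * rf_Y)"
      unfolding mult rf_eval_x_X[symmetric] hom_rf_eval_x using X Y by (simp add: \<phi>_def u_def v_def)
    finally have "poisson_bracket (rf_of_poly_x q * rf_Y) (\<phi> rf_X) (\<phi> rf_Y) = \<phi> (rf_of_poly_x q * rf_Y)"
      using X Y by (simp add: \<phi>_def u_def v_def)
    thus ?thesis using bij hom by (simp add: poisson_auts_iff \<phi>_def)
  qed
qed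

section \<open>The exact sequence\<close>

lemma pcompose_X [simp]: "pcompose r (pCons 0 1) = r"
  unfolding one_pCons by (rule pcompose_idR)

lemma rf_of_poly_x_X [simp]: "rf_of_poly_x (pCons 0 1) = rf_X"
  unfolding one_pCons by (simp add: rf_of_poly_x_def rf_X_def)

text \<open>With q = x p the condition says that q is semi-invariant under a x - b with factor e a.
  Automorphisms yield this form, and it is convenient for composing and inverting affine
  maps.\<close>

lemma E_set_iff:
  "(a, b, e) \<in> E_set p \<longleftrightarrow> a \<noteq> 0 \<and> e \<in> {1, -1} \<and>
     pcompose (pCons 0 p) [:- b, a:] = smult (of_int e * a) (pCons 0 p)"
proof (cases "a = 0")
  case False
  have "of_int e * [:0, 1:] * p = smult (of_int e) (pCons 0 p)"
    by (simp add: of_int_poly)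
  moreover have "[:- b, a:] * pcompose p [:- b, a:] = pcompose (pCons 0 p) [:- b, a:]"
    by (simp add: pcompose_pCons)
  moreover have "smult (inverse a) r = smult (of_int e) s \<longleftrightarrow> r = smult (of_int e * a) s" for r s :: "'a poly"
  proof
    assume "smult (inverse a) r = smult (of_int e) s"
    hence "smult a (smult (inverse a) r) = smult a (smult (of_int e) s)" by simp
    thus "r = smult (of_int e * a) s" using False by (simp add: mult.commute)
  qed (use False in \<open>simp add: field_simps\<close>)
  ultimately show ?thesis using False by (simp only: E_set_def mem_Collect_eq case_prod_conv)
qed (simp add: E_set_def)

lemma group_GL2: "group (GL2 :: ('k :: field ^ 2 ^ 2) monoid)"
proof (rule groupI)
  fix A :: "'k ^ 2 ^ 2" assume "A \<in> carrier GL2"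
  then obtain B where "A ** B = Finite_Cartesian_Product.mat 1" "B ** A = Finite_Cartesian_Product.mat 1" by (auto simp: GL2_def invertible_def)
  thus "\<exists>B\<in>carrier GL2. B \<otimes>\<^bsub>GL2\<^esub> A = \<one>\<^bsub>GL2\<^esub>"
    by (auto simp: GL2_def invertible_def intro!: bexI[of _ B])
qed (auto simp: GL2_def invertible_mult matrix_mul_assoc invertible_def[of "Finite_Cartesian_Product.mat 1"])

lemma group_sign_group: "group sign_group"
  by (rule groupI) (auto simp: sign_group_def)

lemma group_GL2_sign: "group (GL2 \<times>\<times> sign_group :: (('k :: field ^ 2 ^ 2) \<times> int) monoid)"
  by (intro DirProd_group group_GL2 group_sign_group)

lemma group_Aut_Poi: "group (Aut_Poi f)"
proof (rule groupI)
  fix \<phi> assume "\<phi> \<in> carrier (Aut_Poi f)"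
  thus "\<exists>\<psi>\<in>carrier (Aut_Poi f). \<psi> \<otimes>\<^bsub>Aut_Poi f\<^esub> \<phi> = \<one>\<^bsub>Aut_Poi f\<^esub>"
    using poisson_auts_inv[of \<phi> f] by (auto simp: Aut_Poi_def)
qed (auto simp: Aut_Poi_def poisson_auts_comp poisson_auts_id comp_assoc simp del: comp_apply)

lemma ratfun_units_simps [simp]:
  "carrier (ratfun_units :: 'k :: field poly fract monoid) = UNIV - {0}"
  "monoid.mult (ratfun_units :: 'k poly fract monoid) = (*)"
  "one (ratfun_units :: 'k poly fract monoid) = 1"
  by (simp_all add: ratfun_units_def ring_of_type_algebra_def)

lemma group_ratfun_units: "group (ratfun_units :: 'k :: field poly fract monoid)"
proof (rule groupI)
  fix x :: "'k poly fract" assume "x \<in> carrier ratfun_units"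
  thus "\<exists>y\<in>carrier ratfun_units. y \<otimes>\<^bsub>ratfun_units\<^esub> x = \<one>\<^bsub>ratfun_units\<^esub>"
    by (intro bexI[of _ "inverse x"]) auto
qed (auto simp: mult_ac)

section \<open>The group structure of G_p\<close>

definition tri_matrix :: "'k :: field \<Rightarrow> 'k \<Rightarrow> 'k ^ 2 ^ 2" where
  "tri_matrix a b = vector [vector [a, 0], vector [b, 1]]"

lemma G_setI: "(a, b, e) \<in> E_set p \<Longrightarrow> (tri_matrix a b, e) \<in> G_set p"
  unfolding G_set_def tri_matrix_def by blast

lemma G_setE:
  assumes "g \<in> G_set p"
  obtains a b e where "g = (tri_matrix a b, e)" "(a, b, e) \<in> E_set p"
  using assms unfolding G_set_def tri_matrix_def by blast

lemma tri_matrix_mult: "tri_matrix a b ** tri_matrix c d = tri_matrix (a * c) (b * c + d)"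
  by (simp add: tri_matrix_def matrix_matrix_mult_def Finite_Cartesian_Product.vec_eq_iff forall_2 sum_2)

lemma tri_matrix_1: "tri_matrix 1 0 = Finite_Cartesian_Product.mat 1"
  by (simp add: tri_matrix_def Finite_Cartesian_Product.mat_def Finite_Cartesian_Product.vec_eq_iff forall_2)

lemma tri_matrix_eq_iff: "tri_matrix a b = tri_matrix c d \<longleftrightarrow> a = c \<and> b = d"
  by (auto simp: tri_matrix_def Finite_Cartesian_Product.vec_eq_iff forall_2)

lemma tri_matrix_invertible: "a \<noteq> 0 \<Longrightarrow> invertible (tri_matrix a b)"
  unfolding invertible_def
  by (rule exI[of _ "tri_matrix (1 / a) (- b / a)"]) (simp add: tri_matrix_mult flip: tri_matrix_1)

text \<open>Composing the affine maps multiplies the factors \<open>e a\<close> and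
  \<open>s c\<close> of the semi-invariant q.\<close>

lemma E_set_mult:
  assumes "(a, b, e) \<in> E_set p" "(c, d, s) \<in> E_set p"
  shows "(a * c, b * c + d, e * s) \<in> E_set p"
proof -
  define q where "q = pCons 0 p"
  have 1: "pcompose q [:- b, a:] = smult (of_int e * a) q" and 2: "pcompose q [:- d, c:] = smult (of_int s * c) q"
    using assms by (simp_all add: E_set_iff q_def)
  have "[:- (b * c + d), a * c:] = pcompose [:- d, c:] [:- b, a:]"
    by (simp add: pcompose_pCons algebra_simps)
  hence "pcompose q [:- (b * c + d), a * c:] = pcompose (pcompose q [:- d, c:]) [:- b, a:]"
    by (simp only: pcompose_assoc)
  also have "\<dots> = smult (of_int (e * s) * (a * c)) q"
    by (simp add: 1 2 pcompose_smult mult_ac)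
  finally show ?thesis using assms by (auto simp: E_set_iff q_def)
qed

lemma E_set_1: "(1, 0, 1) \<in> E_set p"
  by (simp add: E_set_iff)

lemma E_set_inverse:
  assumes "(a, b, e) \<in> E_set p"
  shows "(1 / a, - b / a, e) \<in> E_set p"
proof -
  define q where "q = pCons 0 p"
  have a: "a \<noteq> 0" and e: "e * e = 1" and 1: "pcompose q [:- b, a:] = smult (of_int e * a) q"
    using assms by (auto simp: E_set_iff q_def)
  define r where "r = pcompose q [:b / a, 1 / a:]"
  have "q = pcompose (pcompose q [:- b, a:]) [:b / a, 1 / a:]"
    using a by (simp add: pcompose_pCons flip: pcompose_assoc)
  also have "\<dots> = smult (of_int e * a) r"
    by (simp add: 1 pcompose_smult r_def)
  finally have "smult (of_int e * (1 / a)) q = smult (of_int e * (1 / a) * (of_int e * a)) r"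
    by (metis smult_smult)
  also have "of_int e * (1 / a) * (of_int e * a) = of_int (e * e)"
    using a by simp
  finally show ?thesis using assms a e by (auto simp: E_set_iff q_def r_def)
qed

lemma subgroup_G_set: "subgroup (G_set p) (GL2 \<times>\<times> sign_group)"
proof (rule group.subgroupI[OF group_GL2_sign])
  show "G_set p \<subseteq> carrier (GL2 \<times>\<times> sign_group)"
    by (auto elim!: G_setE simp: E_set_iff GL2_def sign_group_def tri_matrix_invertible)
  show "G_set p \<noteq> {}"
    using G_setI[OF E_set_1] by blast
  show "g \<otimes>\<^bsub>GL2 \<times>\<times> sign_group\<^esub> h \<in> G_set p" if "g \<in> G_set p" "h \<in> G_set p" for g h
    using that E_set_mult by (auto elim!: G_setE simp: GL2_def sign_group_def tri_matrix_mult intro!: G_setI)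
  show "inv\<^bsub>GL2 \<times>\<times> sign_group\<^esub> g \<in> G_set p" if "g \<in> G_set p" for g
  proof -
    obtain a b e where g: "g = (tri_matrix a b, e)" and abe: "(a, b, e) \<in> E_set p"
      using \<open>g \<in> G_set p\<close> by (rule G_setE)
    note E_set_inverse[OF abe]
    hence h: "(tri_matrix (1 / a) (- b / a), e) \<in> G_set p" by (rule G_setI)
    have "inv\<^bsub>GL2 \<times>\<times> sign_group\<^esub> g = (tri_matrix (1 / a) (- b / a), e)"
      using abe by (intro group.inv_equality[OF group_GL2_sign])
        (auto simp: g GL2_def sign_group_def E_set_iff tri_matrix_mult tri_matrix_1 tri_matrix_invertible)
    thus ?thesis using h by simp
  qed
qed

section \<open>The projection of automorphisms onto G_p\<close>

definition aut_data :: "('k :: field_char_0 ratfun2 \<Rightarrow> 'k ratfun2) \<Rightarrow> 'k \<times> 'k \<times> int \<Rightarrow> bool" where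
  "aut_data \<phi> = (\<lambda>(a, b, e). \<phi> rf_X = rf_of_poly_x [:- b, a:] \<and>
     (\<exists>h. h \<noteq> 0 \<and> \<phi> rf_Y = rf_of_x h * rf_Y powi e))"

text \<open>h y^e is an eigenvector of y d/dy with eigenvalue e, which recovers the
  exponent.\<close>

lemma monomial_unique:
  fixes h h' :: "'k :: field_char_0 poly fract"
  assumes eq: "rf_of_x h * rf_Y powi e = rf_of_x h' * rf_Y powi e'" and h: "h \<noteq> 0"
  shows "e = e'" "h = h'"
proof -
  define w where "w = rf_of_x h * rf_Y powi e"
  have "of_int e * w = of_int e' * w"
    unfolding w_def by (metis eq monomial_euler)
  hence "of_int e = (of_int e' :: 'k ratfun2)"
    using h by (simp add: w_def)
  hence "rf_const (of_int e :: 'k) = rf_const (of_int e')" by simp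
  thus "e = e'" by (metis rf_const.eq_iff of_int_eq_iff)
  thus "h = h'" using eq by simp
qed

lemma aut_data_unique:
  assumes "aut_data \<phi> (a, b, e)" "aut_data \<phi> (a', b', e')"
  shows "(a, b, e) = (a', b', e')"
proof -
  obtain h h' where "h \<noteq> 0" "\<phi> rf_Y = rf_of_x h * rf_Y powi e" "\<phi> rf_Y = rf_of_x h' * rf_Y powi e'"
    using assms by (auto simp: aut_data_def)
  hence "e = e'" using monomial_unique(1) by metis
  thus ?thesis using assms by (auto simp: aut_data_def)
qed

text \<open>\<phi>(c x - d) = c (a x - b) - d, which is the product of the two lower triangular
  matrices in the same order; hence the projection is a homomorphism and not an
  antihomomorphism.\<close>

lemma aut_data_comp:
  assumes "ratfun2_hom \<phi>" "ratfun2_hom \<psi>" "aut_data \<phi> (a, b, e)" "aut_data \<psi> (c, d, s)"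
  shows "aut_data (\<phi> \<circ> \<psi>) (a * c, b * c + d, e * s)"
proof -
  interpret ratfun2_hom \<phi> by fact
  obtain h k where h: "h \<noteq> 0" "\<phi> rf_Y = rf_of_x h * rf_Y powi e"
    and k: "k \<noteq> 0" "\<psi> rf_Y = rf_of_x k * rf_Y powi s"
    using assms by (auto simp: aut_data_def)
  have X: "\<phi> rf_X = rf_of_poly_x [:- b, a:]" using assms by (simp add: aut_data_def)
  have "(\<phi> \<circ> \<psi>) rf_X = rf_of_poly_x (pcompose [:- d, c:] [:- b, a:])"
  proof -
    have "\<phi> (rf_of_poly_x g) = rf_of_poly_x (pcompose g [:- b, a:])" for g
      using hom_rf_eval_x[of rf_X g] unfolding X rf_eval_x_X rf_eval_x_rf_of_poly_x .
    thus ?thesis using assms(4) by (simp add: aut_data_def)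
  qed
  also have "pcompose [:- d, c:] [:- b, a:] = [:- (b * c + d), a * c:]"
    by (simp add: pcompose_pCons algebra_simps)
  finally have "(\<phi> \<circ> \<psi>) rf_X = rf_of_poly_x [:- (b * c + d), a * c:]" .
  moreover have "rf_dy (\<phi> (rf_of_x k)) = 0" by (rule rf_dy_hom_of_x) (simp add: X)
  then obtain k' where k': "\<phi> (rf_of_x k) = rf_of_x k'" using rf_dy_eq_0 by blast
  have "k' \<noteq> 0" using k(1) k' nonzero[of "rf_of_x k"] by auto
  moreover have "(\<phi> \<circ> \<psi>) rf_Y = rf_of_x (k' * h powi s) * rf_Y powi (e * s)"
  proof -
    have "rf_of_x (h powi s) = rf_of_x h powi s"
      by (simp add: power_int_def rf_of_x.hom_power rf_of_x.hom_inverse)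
    thus ?thesis
      by (simp add: k mult power_int h k' power_int_mult_distrib power_int_mult rf_of_x.hom_mult)
  qed
  ultimately show ?thesis using h(1) unfolding aut_data_def by auto
qed

text \<open>Well defined on Poisson automorphisms: the data exist by \<open>poisson_aut_data\<close>
  and are unique by \<open>aut_data_unique\<close>.\<close>

definition aut_proj :: "('k :: field_char_0 ratfun2 \<Rightarrow> 'k ratfun2) \<Rightarrow> ('k ^ 2 ^ 2) \<times> int" where
  "aut_proj \<phi> = (THE g. \<exists>a b e. aut_data \<phi> (a, b, e) \<and> g = (tri_matrix a b, e))"

lemma aut_proj_eq: "aut_data \<phi> (a, b, e) \<Longrightarrow> aut_proj \<phi> = (tri_matrix a b, e)"
  unfolding aut_proj_def by (rule the_equality) (use aut_data_unique in blast)+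

lemma potential_eq: "rf_of_poly_x p * rf_X * rf_Y = rf_of_poly_x (pCons 0 p) * rf_Y"
  by (simp add: rf_of_poly_x_pCons mult_ac)

lemma poisson_aut_data:
  fixes p :: "'k :: field_char_0 poly"
  assumes p: "Polynomial.degree p \<ge> 2" and \<phi>: "\<phi> \<in> poisson_auts (rf_of_poly_x p * rf_X * rf_Y)"
  obtains a b e where "(a, b, e) \<in> E_set p" "aut_data \<phi> (a, b, e)"
proof -
  have q: "Polynomial.degree (pCons 0 p) \<ge> 3" using p by auto
  note \<phi>' = \<phi>[unfolded potential_eq]
  obtain a b h n where *: "a \<noteq> 0" "h \<noteq> 0" "\<phi> rf_X = rf_of_poly_x [:- b, a:]"
    "\<phi> rf_Y = rf_of_x h * rf_Y powi n" "pcompose (pCons 0 p) [:- b, a:] = smult (of_int n * a) (pCons 0 p)"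
    using poisson_aut_form[OF q \<phi>'] by metis
  have "n \<in> {1, -1}" by (rule poisson_aut_exponent[OF q \<phi>' _ *(4)]) (simp add: *)
  with * show thesis by (intro that[of a b n]) (auto simp: E_set_iff aut_data_def)
qed

lemma aut_of_data:
  assumes "(a, b, e) \<in> E_set p" "h \<noteq> 0"
  shows "aut_of a b e h \<in> poisson_auts (rf_of_poly_x p * rf_X * rf_Y)" "aut_data (aut_of a b e h) (a, b, e)"
  using assms aut_of(1-3)[of a h e b] aut_of(4)[of a h e "pCons 0 p" b] unfolding potential_eq E_set_iff aut_data_def by blast+

text \<open>A unit h acts by x -> x, y -> h y. Such maps fix k(x), so composing them multiplies the
  units, and they are exactly the automorphisms with data (1, 0, 1).\<close>

theorem Aut_Poi_exact:
  fixes p :: "'k :: field_char_0 poly"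
  assumes p: "Polynomial.degree p \<ge> 2"
  shows "short_exact (ratfun_units :: 'k poly fract monoid) (Aut_Poi (rf_of_poly_x p * rf_X * rf_Y))
    (G_group p) (aut_of 1 0 1) aut_proj"
  unfolding short_exact_def
proof (intro conjI)
  let ?f = "rf_of_poly_x p * rf_X * rf_Y"
  note form = poisson_aut_data[OF p]
  show "group (ratfun_units :: 'k poly fract monoid)" "group (Aut_Poi ?f)"
    by (rule group_ratfun_units group_Aut_Poi)+
  show "group (G_group p)"
    by (rule subgroup.subgroup_is_group[OF subgroup_G_set group_GL2_sign])
  have hom: "ratfun2_hom \<phi>" if "\<phi> \<in> poisson_auts ?f" for \<phi>
    using that by (simp add: poisson_auts_iff)
  have \<iota>: "ratfun2_hom (aut_of 1 0 1 h)" "aut_of 1 0 1 h rf_X = rf_X" "aut_of 1 0 1 h rf_Y = rf_of_x h * rf_Y"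
    if "h \<noteq> 0" for h :: "'k poly fract"
    using aut_of(1-3)[of 1 h 1 0] that by simp_all
  have \<iota>_of_x: "aut_of 1 0 1 h (rf_of_x k) = rf_of_x k" if "h \<noteq> 0" for h k :: "'k poly fract"
  proof -
    interpret ratfun2_hom "aut_of 1 0 1 h" by (rule \<iota>[OF that])
    show ?thesis
      using rf_of_x_in_subfield[of "{w. aut_of 1 0 1 h w = w}" k] \<iota>[OF that] add mult hom_inverse by simp
  qed
  show "aut_of 1 0 1 \<in> mon ratfun_units (Aut_Poi ?f)"
    unfolding mon_def
  proof (intro CollectI conjI homI)
    show "aut_of 1 0 1 h \<in> carrier (Aut_Poi ?f)" if "h \<in> carrier ratfun_units" for h :: "'k poly fract"
      using aut_of_data(1)[OF E_set_1] that by (simp add: Aut_Poi_def)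
    show "aut_of 1 0 1 (h \<otimes>\<^bsub>ratfun_units\<^esub> k) = aut_of 1 0 1 h \<otimes>\<^bsub>Aut_Poi ?f\<^esub> aut_of 1 0 1 k"
      if "h \<in> carrier ratfun_units" "k \<in> carrier ratfun_units" for h k :: "'k poly fract"
    proof -
      have hk: "h \<noteq> 0" "k \<noteq> 0" "h * k \<noteq> 0" using that by auto
      interpret ratfun2_hom "aut_of 1 0 1 h" by (rule \<iota>[OF hk(1)])
      have "aut_of 1 0 1 (h * k) = aut_of 1 0 1 h \<circ> aut_of 1 0 1 k"
        using hk by (intro ratfun2_hom_eqI ratfun2_hom_comp \<iota>)
          (simp_all add: \<iota> \<iota>_of_x mult rf_of_x.hom_mult)
      thus ?thesis by (simp add: Aut_Poi_def)
    qed
    show "inj_on (aut_of 1 0 1) (carrier (ratfun_units :: 'k poly fract monoid))"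
    proof (rule inj_onI)
      fix h k :: "'k poly fract"
      assume hk: "h \<in> carrier ratfun_units" "k \<in> carrier ratfun_units" "aut_of 1 0 1 h = aut_of 1 0 1 k"
      hence "rf_of_x h * rf_Y = rf_of_x k * rf_Y" using \<iota>(3) by (metis DiffD2 ratfun_units_simps(1) singletonI)
      thus "h = k" by simp
    qed
  qed
  show "aut_proj \<in> epi (Aut_Poi ?f) (G_group p)"
    unfolding epi_def
  proof (intro CollectI conjI homI)
    show proj_mem: "aut_proj \<phi> \<in> carrier (G_group p)" if "\<phi> \<in> carrier (Aut_Poi ?f)" for \<phi>
    proof -
      have "\<phi> \<in> poisson_auts ?f" using that by (simp add: Aut_Poi_def)
      then obtain a b e where "(a, b, e) \<in> E_set p" "aut_data \<phi> (a, b, e)" by (rule form)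
      thus ?thesis by (simp add: aut_proj_eq G_setI)
    qed
    show "aut_proj (\<phi> \<otimes>\<^bsub>Aut_Poi ?f\<^esub> \<psi>) = aut_proj \<phi> \<otimes>\<^bsub>G_group p\<^esub> aut_proj \<psi>"
      if "\<phi> \<in> carrier (Aut_Poi ?f)" "\<psi> \<in> carrier (Aut_Poi ?f)" for \<phi> \<psi>
    proof -
      have \<phi>: "\<phi> \<in> poisson_auts ?f" and \<psi>: "\<psi> \<in> poisson_auts ?f" using that by (simp_all add: Aut_Poi_def)
      obtain a b e where 1: "aut_data \<phi> (a, b, e)" using form[OF \<phi>] by blast
      obtain c d s where 2: "aut_data \<psi> (c, d, s)" using form[OF \<psi>] by blast
      show ?thesis
        using aut_proj_eq[OF 1] aut_proj_eq[OF 2] aut_proj_eq[OF aut_data_comp[OF hom[OF \<phi>] hom[OF \<psi>] 1 2]]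
        by (simp add: Aut_Poi_def GL2_def sign_group_def tri_matrix_mult)
    qed
    show "aut_proj ` carrier (Aut_Poi ?f) = carrier (G_group p)"
    proof
      show "aut_proj ` carrier (Aut_Poi ?f) \<subseteq> carrier (G_group p)"
        using proj_mem by blast
      show "carrier (G_group p) \<subseteq> aut_proj ` carrier (Aut_Poi ?f)"
      proof
        fix g assume "g \<in> carrier (G_group p)"
        then obtain a b e where g: "g = (tri_matrix a b, e)" "(a, b, e) \<in> E_set p" by (auto elim: G_setE)
        \<comment> \<open>Any nonzero h would give a preimage; h = 1 is chosen.\<close>
        note \<phi> = aut_of_data[OF g(2) one_neq_zero]
        have "g = aut_proj (aut_of a b e 1)" using aut_proj_eq[OF \<phi>(2)] g(1) by simp
        thus "g \<in> aut_proj ` carrier (Aut_Poi ?f)"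
          using \<phi>(1) by (auto simp: Aut_Poi_def)
      qed
    qed
  qed
  show "aut_of 1 0 1 ` carrier ratfun_units = kernel (Aut_Poi ?f) (G_group p) aut_proj"
  proof
    show "aut_of 1 0 1 ` carrier ratfun_units \<subseteq> kernel (Aut_Poi ?f) (G_group p) aut_proj"
      using aut_of_data(1)[OF E_set_1[of p]] aut_proj_eq[OF aut_of_data(2)[OF E_set_1[of p]]]
      by (auto simp: kernel_def Aut_Poi_def GL2_def sign_group_def tri_matrix_1)
    show "kernel (Aut_Poi ?f) (G_group p) aut_proj \<subseteq> aut_of 1 0 1 ` carrier ratfun_units"
    proof
      fix \<phi> assume ker: "\<phi> \<in> kernel (Aut_Poi ?f) (G_group p) aut_proj"
      hence \<phi>: "\<phi> \<in> poisson_auts ?f" by (simp add: kernel_def Aut_Poi_def)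
      obtain a b e where data: "aut_data \<phi> (a, b, e)" using form[OF \<phi>] by blast
      have "(tri_matrix a b, e) = (tri_matrix 1 0, 1)"
        using ker aut_proj_eq[OF data] by (simp add: kernel_def GL2_def sign_group_def tri_matrix_1)
      hence "a = 1" "b = 0" "e = 1" by (simp_all add: tri_matrix_eq_iff)
      then obtain h where h: "h \<noteq> 0" "\<phi> rf_X = rf_X" "\<phi> rf_Y = rf_of_x h * rf_Y"
        using data by (auto simp: aut_data_def rf_of_poly_x_linear)
      have "\<phi> = aut_of 1 0 1 h"
        by (rule ratfun2_hom_eqI[OF hom[OF \<phi>]]) (use h \<iota> in simp_all)
      thus "\<phi> \<in> aut_of 1 0 1 ` carrier ratfun_units" using h(1) by auto
    qed
  qed
qed

section \<open>The size of \<open>G\<^sub>p\<close>\<close>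

text \<open>Comparing coefficients in degree d + 1 gives a^(d + 1) = e a.\<close>

lemma E_set_power:
  assumes "(a, b, e) \<in> E_set p" and "p \<noteq> 0"
  shows "a ^ Polynomial.degree p = of_int e"
proof -
  have a: "a \<noteq> 0" and eq: "pcompose (pCons 0 p) [:- b, a:] = smult (of_int e * a) (pCons 0 p)"
    using assms by (simp_all add: E_set_iff)
  have 1: "lead_coeff (pcompose (pCons 0 p) [:- b, a:]) = lead_coeff p * (a * a ^ Polynomial.degree p)"
    using a assms(2) by (subst lead_coeff_comp) simp_all
  have 2: "lead_coeff (smult (of_int e * a) (pCons 0 p)) = of_int e * a * lead_coeff p"
    using assms(2) by (simp add: lead_coeff_smult del: smult_pCons)
  show ?thesis using 1 2 a assms(2) unfolding eq by simp
qed

text \<open>The root 0 of q would be carried to all multiples - n b, infinitely many in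
  characteristic zero.\<close>

lemma E_set_translation:
  fixes p :: "'k :: field_char_0 poly"
  assumes "(1, b, 1) \<in> E_set p" and p: "p \<noteq> 0"
  shows "b = 0"
proof (rule ccontr)
  assume b: "b \<noteq> 0"
  define q where "q = pCons 0 p"
  have "pcompose q [:- b, 1:] = q" using assms by (simp add: E_set_iff q_def)
  hence shift: "poly q (z - b) = poly q z" for z
    using poly_pcompose[of q "[:- b, 1:]" z] by simp
  have "poly q (- of_nat n * b) = 0" for n
  proof (induction n)
    case (Suc n)
    moreover have "- of_nat n * b - b = - of_nat (Suc n) * b" by (simp add: algebra_simps)
    ultimately show ?case using shift[of "- of_nat n * b"] by metis
  qed (simp add: q_def)
  hence "range (\<lambda>n. - of_nat n * b) \<subseteq> {z. poly q z = 0}" by auto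
  moreover have "infinite (range (\<lambda>n. - of_nat n * b))"
    by (rule range_inj_infinite) (use b in \<open>simp add: inj_on_def\<close>)
  ultimately have "q = 0" using poly_roots_finite finite_subset by blast
  thus False using p by (simp add: q_def)
qed

text \<open>\<open>E_set_power\<close> recovers e from a. Composing one element with the inverse of
  the other leaves a translation, which must be trivial.\<close>

lemma E_set_inj:
  fixes p :: "'k :: field_char_0 poly"
  assumes "(a, b, e) \<in> E_set p" "(a, b', e') \<in> E_set p" and p: "p \<noteq> 0"
  shows "b = b'" "e = e'"
proof -
  show e: "e = e'"
    using E_set_power[OF assms(1) p] E_set_power[OF assms(2) p] by simp
  have "(1, b' / a - b / a, 1) \<in> E_set p"
    using E_set_mult[OF assms(2) E_set_inverse[OF assms(1)]] assms(1) e by (auto simp: E_set_iff)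
  hence "b' / a - b / a = 0" by (rule E_set_translation[OF _ p])
  thus "b = b'" using assms(1) by (simp add: E_set_iff)
qed

lemma roots_of_unity_bound:
  fixes n :: nat
  assumes "n > 0"
  shows "finite {a :: 'a :: idom. a ^ n = 1}" "card {a :: 'a. a ^ n = 1} \<le> n"
proof -
  define r :: "'a poly" where "r = Polynomial.monom 1 n - 1"
  have r: "{a. a ^ n = 1} = {a. poly r a = 0}" by (simp add: r_def poly_monom)
  have "coeff r n = 1" using assms by (simp add: r_def)
  hence r0: "r \<noteq> 0" by auto
  have "Polynomial.degree r \<le> n" unfolding r_def by (intro degree_diff_le degree_monom_le) simp
  thus "finite {a :: 'a. a ^ n = 1}" "card {a :: 'a. a ^ n = 1} \<le> n"
    using poly_roots_finite[OF r0] card_poly_roots_bound[OF r0] unfolding r by auto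
qed

text \<open>By \<open>E_set_inj\<close> an element is determined by \<open>a\<close>, and e^2 = 1
  makes \<open>a\<close> a root of unity of order dividing 2 d.\<close>

lemma card_G_set_le:
  fixes p :: "'k :: field_char_0 poly"
  assumes p: "Polynomial.degree p > 0"
  shows "finite (G_set p)" "card (G_set p) \<le> 2 * Polynomial.degree p"
proof -
  let ?U = "{a :: 'k. a ^ (2 * Polynomial.degree p) = 1}"
  have p0: "p \<noteq> 0" using p by auto
  note U = roots_of_unity_bound[where ?'a = 'k, of "2 * Polynomial.degree p"]
  have "fst ` E_set p \<subseteq> ?U"
  proof
    fix a assume "a \<in> fst ` E_set p"
    then obtain b e where E: "(a, b, e) \<in> E_set p" by auto
    have "a ^ (Polynomial.degree p * 2) = of_int e ^ 2"
      unfolding power_mult E_set_power[OF E p0] ..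
    also have "\<dots> = 1" using E by (auto simp: E_set_iff)
    finally show "a \<in> ?U" by (simp add: mult.commute)
  qed
  moreover have "inj_on fst (E_set p)"
  proof (rule inj_onI)
    fix s t assume "s \<in> E_set p" "t \<in> E_set p" "fst s = fst t"
    moreover obtain a b e where "s = (a, b, e)" by (cases s)
    moreover obtain a' b' e' where "t = (a', b', e')" by (cases t)
    ultimately show "s = t" using E_set_inj[of a b e p b' e'] p0 by simp
  qed
  ultimately have E: "finite (E_set p)" "card (E_set p) \<le> 2 * Polynomial.degree p"
    using U p by (auto intro: inj_on_finite order.trans[OF card_inj_on_le])
  have "G_set p \<subseteq> (\<lambda>(a, b, e). (tri_matrix a b, e)) ` E_set p"
    by (force elim: G_setE)
  thus "finite (G_set p)" "card (G_set p) \<le> 2 * Polynomial.degree p"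
    using E surj_card_le[OF E(1)] by (auto intro: finite_subset order.trans)
qed

text \<open>
  The affine map \<open>z \<mapsto> a z - b\<close> permutes the roots \<open>0, r\<^sub>1, \<dots>, r\<^sub>d\<close> of \<open>x p(x)\<close>. If \<open>a \<noteq> 1\<close>, then
  comparing the sum of all roots with the sum of the first \<open>2 d\<close> points of the orbit of \<open>0\<close>
  gives an integer relation between the \<open>r\<^sub>i\<close>.
\<close>

lemma E_set_fst_eq_1:
  fixes p :: "'k :: field_char_0 poly" and r :: "nat \<Rightarrow> 'k alg_closure"
  assumes deg: "Polynomial.degree p = d" and d: "d \<ge> 2"
    and roots: "\<And>i. i \<in> {1..d} \<Longrightarrow> poly (map_poly to_ac p) (r i) = 0" and inj: "inj_on r {1..d}"
    and indep: "Modules.module.independent (\<lambda>n z. of_int n * z) (r ` {1..d})"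
    and E: "(a, b, e) \<in> E_set p"
  shows "a = 1"
proof (rule ccontr)
  assume "a \<noteq> 1"
  interpret ac: inj_idom_hom "to_ac :: 'k \<Rightarrow> 'k alg_closure"
    by unfold_locales simp_all
  define A B where "A = to_ac a" and "B = to_ac b"
  define P where "P = map_poly to_ac p"
  define q where "q = pCons 0 p"
  define Q where "Q = map_poly to_ac q"
  define W where "W = r ` {1..d}"
  define \<sigma> where "\<sigma> z = A * z - B" for z
  have p0: "p \<noteq> 0" using deg d by auto
  have A1: "A - 1 \<noteq> 0" and A0: "A \<noteq> 0"
    using \<open>a \<noteq> 1\<close> E ac.eq_iff[of a 1] by (auto simp: A_def E_set_iff)
  have "a ^ (d * 2) = of_int e ^ 2"
    unfolding power_mult deg[symmetric] E_set_power[OF E p0] ..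
  hence "a ^ (2 * d) = 1" using E by (auto simp: E_set_iff mult.commute)
  hence A_pow: "A ^ (2 * d) = 1" by (simp add: A_def flip: ac.hom_power)
  have W: "finite W" "card W = d" unfolding W_def using inj by (simp_all add: card_image)
  have P0: "P \<noteq> 0" "Polynomial.degree P = d" using p0 deg by (simp_all add: P_def)
  \<comment> \<open>The d distinct roots exhaust those of a polynomial of degree d.\<close>
  have W_roots: "{z. poly P z = 0} = W"
  proof (rule card_seteq[symmetric])
    show "W \<subseteq> {z. poly P z = 0}" using roots by (auto simp: W_def P_def)
    show "card {z. poly P z = 0} \<le> card W" using card_poly_roots_bound[OF P0(1)] P0 W by simp
  qed (rule poly_roots_finite[OF P0(1)])
  have indepD: "u w = 0" if "(\<Sum>w\<in>W. of_int (u w) * w) = 0" "w \<in> W" for u :: "'k alg_closure \<Rightarrow> int" and w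
    using module.independentD[OF module_of_int indep[folded W_def] W(1) order.refl that] .
  \<comment> \<open>Coefficient 1 at the element 0 would be a nontrivial relation. Hence
    \<open>insert 0 W\<close> has d + 1 points.\<close>
  have W0: "0 \<notin> W"
  proof
    assume "0 \<in> W"
    moreover have "(\<Sum>w\<in>W. of_int (if w = 0 then 1 else 0) * w) = 0"
      by (rule sum.neutral) simp
    ultimately show False using indepD[of "\<lambda>w. if w = 0 then 1 else 0" 0] by fastforce
  qed
  have Q: "poly Q z = 0 \<longleftrightarrow> z \<in> insert 0 W" for z
    using W_roots by (auto simp: Q_def q_def ac.map_poly_pCons_hom P_def)
  have comp: "pcompose q [:- b, a:] = smult (of_int e * a) q" using E by (simp add: E_set_iff q_def)
  have \<sigma>_root: "\<sigma> z \<in> insert 0 W" if "z \<in> insert 0 W" for z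
  proof -
    have "poly Q (\<sigma> z) = poly (pcompose Q [:- B, A:]) z"
      by (simp add: poly_pcompose \<sigma>_def mult.commute)
    also have "pcompose Q [:- B, A:] = map_poly to_ac (pcompose q [:- b, a:])"
      by (simp add: ac.map_poly_pcompose Q_def A_def B_def ac.map_poly_pCons_hom ac.hom_uminus)
    also have "\<dots> = smult (to_ac (of_int e * a)) Q"
      unfolding comp by (simp add: ac.map_poly_hom_smult Q_def)
    finally have "poly Q (\<sigma> z) = 0" using iffD2[OF Q that] by simp
    thus ?thesis by (simp only: Q)
  qed
  have "inj \<sigma>" using A0 by (simp add: inj_def \<sigma>_def)
  hence inj_\<sigma>: "inj_on \<sigma> (insert 0 W)" by (rule inj_on_subset) simp
  have "\<sigma> ` insert 0 W \<subseteq> insert 0 W" by (rule image_subsetI) (rule \<sigma>_root)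
  hence "\<sigma> ` insert 0 W = insert 0 W" using W by (intro endo_inj_surj inj_\<sigma>) simp_all
  hence "(\<Sum>z\<in>insert 0 W. z) = (\<Sum>z\<in>\<sigma> ` insert 0 W. z)" by simp
  also have "\<dots> = (\<Sum>z\<in>insert 0 W. \<sigma> z)"
    using sum.reindex[OF inj_\<sigma>, of "\<lambda>z. z"] by (simp only: comp_def)
  finally have "(\<Sum>z\<in>insert 0 W. z) = (\<Sum>z\<in>insert 0 W. A * z - B)" unfolding \<sigma>_def .
  hence sum_W: "(A - 1) * \<Sum>W = of_nat (d + 1) * B"
    using W W0 by (simp add: sum_subtractf sum_distrib_left algebra_simps)
  define z where "z k = (\<sigma> ^^ k) 0" for k
  have z_Suc: "z (Suc k) = A * z k - B" for k by (simp add: z_def \<sigma>_def)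
  have z_root: "z k \<in> insert 0 W" for k
    by (induction k) (use \<sigma>_root in \<open>simp_all add: z_def\<close>)
  \<comment> \<open>Closed form of the orbit of 0. As A^(2 d) = 1, it returns to 0 after 2 d steps,
    so shifting the summation index does not change \<open>T\<close>.\<close>
  have "(A - 1) * z k = B - B * A ^ k" for k
  proof (induction k)
    case (Suc k)
    have "(A - 1) * z (Suc k) = A * ((A - 1) * z k) - (A - 1) * B"
      by (simp add: z_Suc algebra_simps)
    thus ?case unfolding Suc.IH by (simp add: algebra_simps)
  qed (simp add: z_def)
  from this[of "2 * d"] have z_2d: "z (2 * d) = 0" using A_pow A1 by simp
  define T where "T = (\<Sum>k<2 * d. z k)"
  have "(\<Sum>k<2 * d. z (Suc k)) + z 0 = T + z (2 * d)"
    unfolding T_def by (metis add.commute sum.lessThan_Suc sum.lessThan_Suc_shift)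
  hence "(\<Sum>k<2 * d. A * z k - B) = T" by (simp add: z_2d z_Suc) (simp add: z_def)
  hence sum_T: "(A - 1) * T = of_nat (2 * d) * B"
    by (simp add: sum_subtractf T_def sum_distrib_left algebra_simps)
  \<comment> \<open>Eliminates \<open>B\<close> between \<open>sum_W\<close> and
    \<open>sum_T\<close>.\<close>
  have "(A - 1) * (of_nat (2 * d) * \<Sum>W) = (A - 1) * (of_nat (d + 1) * T)"
    using sum_W sum_T by (metis mult.left_commute)
  hence rel: "of_nat (2 * d) * \<Sum>W = of_nat (d + 1) * T" using A1 by simp
  \<comment> \<open>Number of visits of the orbit to \<open>w\<close>; it turns \<open>T\<close>
    into an integer combination of the roots.\<close>
  define m where "m w = card {k. k < 2 * d \<and> z k = w}" for w
  have "T = (\<Sum>w\<in>insert 0 W. \<Sum>k\<in>{k. k \<in> {..<2 * d} \<and> z k = w}. z k)"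
    unfolding T_def by (rule sum.group[symmetric]) (use W z_root in auto)
  also have "\<dots> = (\<Sum>w\<in>insert 0 W. of_nat (m w) * w)"
    by (intro sum.cong refl) (simp add: m_def)
  finally have T: "T = (\<Sum>w\<in>W. of_nat (m w) * w)" using W W0 by simp
  have "(\<Sum>w\<in>W. of_int (int (2 * d) - int (d + 1) * int (m w)) * w) = 0"
    using rel unfolding T by (simp add: sum_distrib_left sum_subtractf left_diff_distrib mult.assoc)
  from indepD[OF this, of "r 1"] have "int (2 * d) = int (d + 1) * int (m (r 1))"
    using d by (auto simp: W_def)
  hence "2 * d = (d + 1) * m (r 1)" by (metis of_nat_eq_iff of_nat_mult)
  \<comment> \<open>The equation 2 d = (d + 1) m has no solution: m = 0 gives d = 0, m = 1 gives d =
    1, and m >= 2 makes the right side at least 2 d + 2.\<close>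
  moreover have "m (r 1) = 0 \<or> m (r 1) = 1 \<or> m (r 1) \<ge> 2" by linarith
  moreover have "(d + 1) * 2 \<le> (d + 1) * m (r 1)" if "m (r 1) \<ge> 2" using that by (rule mult_le_mono2)
  ultimately show False using d by auto
qed

text \<open>With trivial G_p the kernel of \<open>aut_proj\<close> is the whole group, so the
  injection in the exact sequence is onto.\<close>

lemma Aut_Poi_iso_units:
  fixes p :: "'k :: field_char_0 poly"
  assumes p: "Polynomial.degree p \<ge> 2" and E: "E_set p = {(1, 0, 1)}"
  shows "Aut_Poi (rf_of_poly_x p * rf_X * rf_Y) \<cong> (ratfun_units :: 'k poly fract monoid)"
proof -
  let ?A = "Aut_Poi (rf_of_poly_x p * rf_X * rf_Y)"
  note exact = Aut_Poi_exact[OF p, unfolded short_exact_def]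
  have G: "aut_proj \<phi> = \<one>\<^bsub>G_group p\<^esub>" if "\<phi> \<in> carrier ?A" for \<phi>
  proof -
    have "aut_proj \<phi> \<in> G_set p" using exact that by (auto simp: epi_def hom_def)
    thus ?thesis using E by (auto elim!: G_setE simp: GL2_def sign_group_def tri_matrix_1)
  qed
  hence "aut_of 1 0 1 ` carrier ratfun_units = carrier ?A"
    using exact by (auto simp: kernel_def)
  hence "aut_of 1 0 1 \<in> iso ratfun_units ?A"
    using exact by (auto simp: iso_def mon_def bij_betw_def)
  hence "(ratfun_units :: 'k poly fract monoid) \<cong> ?A" by (rule is_isoI)
  thus ?thesis by (rule group.iso_sym[OF group_ratfun_units])
qed

theorem corollary5p7:
  fixes p :: "'k :: field_char_0 poly" and d :: nat
  assumes "Polynomial.degree p = d" and "d \<ge> 2"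
  shows
    "(subgroup (G_set p) (GL2 \<times>\<times> sign_group) \<and>
      (\<exists>\<iota> \<pi>. short_exact (ratfun_units :: 'k poly fract monoid) (Aut_Poi (rf_of_poly_x p * rf_X * rf_Y)) (G_group p) \<iota> \<pi>)) \<and>
     (finite (G_set p) \<and> card (G_set p) \<le> d * (d + 1)) \<and>
     (\<forall>r :: nat \<Rightarrow> 'k alg_closure.
        (\<forall>i\<in>{1..d}. poly (map_poly to_ac p) (r i) = 0) \<and>
        inj_on r {1..d} \<and>
        Modules.module.independent (\<lambda>n z. of_int n * z) (r ` {1..d}) \<and>
        (\<forall>i\<in>{1..d}. \<forall>j\<in>{1..d}. i \<noteq> j \<longrightarrow> r i ^ (2 * d) \<noteq> r j ^ (2 * d)) \<longrightarrow>
        card (G_set p) = 1 \<and> Aut_Poi (rf_of_poly_x p * rf_X * rf_Y) \<cong> (ratfun_units :: 'k poly fract monoid))"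
proof (intro conjI allI impI)
  have p: "Polynomial.degree p \<ge> 2" "Polynomial.degree p > 0" and p0: "p \<noteq> 0" using assms by auto
  show "subgroup (G_set p) (GL2 \<times>\<times> sign_group)" by (rule subgroup_G_set)
  show "\<exists>\<iota> \<pi>. short_exact (ratfun_units :: 'k poly fract monoid) (Aut_Poi (rf_of_poly_x p * rf_X * rf_Y)) (G_group p) \<iota> \<pi>"
    using Aut_Poi_exact[OF p(1)] by blast
  show "finite (G_set p)" by (rule card_G_set_le[OF p(2)])
  have "2 * d \<le> d * (d + 1)" using assms(2) by simp
  thus "card (G_set p) \<le> d * (d + 1)" using card_G_set_le(2)[OF p(2)] assms(1) by (metis order.trans)
  fix r :: "nat \<Rightarrow> 'k alg_closure"
  assume r: "(\<forall>i\<in>{1..d}. poly (map_poly to_ac p) (r i) = 0) \<and>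
        inj_on r {1..d} \<and>
        Modules.module.independent (\<lambda>n z. of_int n * z) (r ` {1..d}) \<and>
        (\<forall>i\<in>{1..d}. \<forall>j\<in>{1..d}. i \<noteq> j \<longrightarrow> r i ^ (2 * d) \<noteq> r j ^ (2 * d))"
  have E: "E_set p = {(1, 0, 1)}"
  proof (intro equalityI subsetI)
    fix t assume t: "t \<in> E_set p"
    obtain a b e where abe: "t = (a, b, e)" by (cases t)
    hence "a = 1" using E_set_fst_eq_1[OF assms] r t by blast
    \<comment> \<open>(1, b, e) and (1, 0, 1) share the first entry, so \<open>E_set_inj\<close>
      identifies them.\<close>
    thus "t \<in> {(1, 0, 1)}" using E_set_inj[OF _ E_set_1 p0] t abe by blast
  qed (use E_set_1 in blast)
  hence "G_set p = {(tri_matrix 1 0, 1)}" by (auto elim!: G_setE intro: G_setI)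
  thus "card (G_set p) = 1" by simp
  show "Aut_Poi (rf_of_poly_x p * rf_X * rf_Y) \<cong> (ratfun_units :: 'k poly fract monoid)"
    by (rule Aut_Poi_iso_units[OF p(1) E])
qed

end
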